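(* The group $\mathrm{PBr}_{A_n}$ is generated by $\{z_{ij}\mid 1\le i<j\le n+1\}$ subject to the relations: (1) $z_{ij}z_{kl}=z_{kl}z_{ij}$ if $k\ge j+1$, or $k\le i\le j\le l$, or $i\le k\le l\le j$. (2) $z_{iy}^{-1}\,(z_{ij}\,z_{xy}\,z_{j+1,k})\,z_{xk}^{-1}=z_{xk}^{-1}\,(z_{j+1,k}\,z_{xy}\,z_{ij})\,z_{iy}^{-1}$ whenever $1\le i<x\le j<y<k\le n+1$.
   Context: Let $n\ge 1$. The braid group $\mathrm{Br}_{n+1}$ is the group with generators $s_1,\dots,s_n$ and relations $s_is_j=s_js_i$ for $|i-j|\ge 2$ and $s_is_{i+1}s_i=s_{i+1}s_is_{i+1}$ for $1\le i\le n-1$. The pure braid group $\mathrm{PBr}_{A_n}$ is the kernel of the homomorphism $\mathrm{Br}_{n+1}\to\mathfrak{S}_{n+1}$ sending $s_i$ to the transposition $(i,i+1)$. For $1\le i\le j\le n$, $\ell_{i,j}\in\mathrm{Br}_{n+1}$ denotes the standard positive lift of the longest element of the parabolic subgroup of $\mathfrak{S}_{n+1}$ generated by $(i,i+1),\dots,(j,j+1)$; explicitly $\ell_{i,j}=(s_i)(s_{i+1}s_i)\cdots(s_js_{j-1}\cdots s_i)$. For $1\le i<j\le n+1$, the generator $z_{ij}$ corresponds to the connected subset $[i,j-1]$ of the path graph with nodes $1,\dots,n$, that is, to the element $\ell_{i,j-1}^2\in\mathrm{PBr}_{A_n}$. *)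

theory Defs
  imports "HOL-Algebra.Sym_Groups"
begin

section \<open>Groups given by generators and relations\<close>

text \<open>A letter \<open>(x, True)\<close> stands for the generator \<open>x\<close>, and \<open>(x, False)\<close> for its inverse.\<close>

type_synonym 'a word = "('a \<times> bool) list"

abbreviation pos :: "'a \<Rightarrow> 'a \<times> bool" where "pos x \<equiv> (x, True)"
abbreviation neg :: "'a \<Rightarrow> 'a \<times> bool" where "neg x \<equiv> (x, False)"

definition words_over :: "'a set \<Rightarrow> 'a word set"
  where "words_over S = lists (S \<times> UNIV)"

text \<open>A relation \<open>u = v\<close> is a pair \<open>(u, v)\<close>. The following is the least congruence on words over
  \<open>S\<close> that contains free cancellation and \<open>R\<close>; its classes are the cosets of the normal closure
  of the elements \<open>u\<close> times \<open>v\<close> inverse in the free group on \<open>S\<close>.\<close>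

inductive pres_eq :: "'a set \<Rightarrow> ('a word \<times> 'a word) set \<Rightarrow> 'a word \<Rightarrow> 'a word \<Rightarrow> bool"
  for S :: "'a set" and R :: "('a word \<times> 'a word) set"
  where
    refl: "w \<in> words_over S \<Longrightarrow> pres_eq S R w w"
  | sym: "pres_eq S R u v \<Longrightarrow> pres_eq S R v u"
  | trans: "pres_eq S R u v \<Longrightarrow> pres_eq S R v w \<Longrightarrow> pres_eq S R u w"
  | cong: "pres_eq S R u u' \<Longrightarrow> pres_eq S R v v' \<Longrightarrow> pres_eq S R (u @ v) (u' @ v')"
  | cancel: "x \<in> S \<Longrightarrow> pres_eq S R [(x, b), (x, \<not> b)] []"
  | rel: "(u, v) \<in> R \<Longrightarrow> u \<in> words_over S \<Longrightarrow> v \<in> words_over S \<Longrightarrow> pres_eq S R u v"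

definition pres_class :: "'a set \<Rightarrow> ('a word \<times> 'a word) set \<Rightarrow> 'a word \<Rightarrow> 'a word set"
  where "pres_class S R w = {v. pres_eq S R w v}"

definition presented_group :: "'a set \<Rightarrow> ('a word \<times> 'a word) set \<Rightarrow> 'a word set monoid"
  where "presented_group S R =
    \<lparr> carrier = pres_class S R ` words_over S,
      mult = (\<lambda>X Y. \<Union>u\<in>X. \<Union>v\<in>Y. pres_class S R (u @ v)),
      one = pres_class S R [] \<rparr>"

primrec word_eval :: "('b, 'm) monoid_scheme \<Rightarrow> ('a \<Rightarrow> 'b) \<Rightarrow> 'a word \<Rightarrow> 'b"
  where
    "word_eval G f [] = \<one>\<^bsub>G\<^esub>"
  | "word_eval G f (l # w) =
      (if snd l then f (fst l) else inv\<^bsub>G\<^esub> (f (fst l))) \<otimes>\<^bsub>G\<^esub> word_eval G f w"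

text \<open>The homomorphism out of a presented group that extends an assignment \<open>f\<close> of the generators.
  It is meaningful only if \<open>f\<close> respects the relations; see \<open>presented_hom_hom\<close> below.\<close>

definition presented_hom :: "('b, 'm) monoid_scheme \<Rightarrow> ('a \<Rightarrow> 'b) \<Rightarrow> 'a word set \<Rightarrow> 'b"
  where "presented_hom G f X = the_elem (word_eval G f ` X)"

lemma words_over_simps [simp]:
  "[] \<in> words_over S"
  "l # w \<in> words_over S \<longleftrightarrow> fst l \<in> S \<and> w \<in> words_over S"
  "u @ v \<in> words_over S \<longleftrightarrow> u \<in> words_over S \<and> v \<in> words_over S"
  by (auto simp: words_over_def mem_Times_iff)

lemma pres_eq_words:
  "pres_eq S R u v \<Longrightarrow> u \<in> words_over S \<and> v \<in> words_over S"
  by (induction rule: pres_eq.induct) auto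

lemma pres_class_self: "w \<in> words_over S \<Longrightarrow> w \<in> pres_class S R w"
  by (simp add: pres_class_def pres_eq.refl)

lemma pres_class_eqI:
  assumes "pres_eq S R u v"
  shows "pres_class S R u = pres_class S R v"
proof -
  have "pres_eq S R u w \<longleftrightarrow> pres_eq S R v w" for w
    using pres_eq.trans[OF assms, of w] pres_eq.trans[OF pres_eq.sym[OF assms], of w] by iprover
  then show ?thesis by (simp add: pres_class_def)
qed

lemma pres_class_eq_iff:
  assumes "u \<in> words_over S"
  shows "pres_class S R u = pres_class S R v \<longleftrightarrow> pres_eq S R u v"
proof
  assume "pres_class S R u = pres_class S R v"
  with pres_class_self[OF assms] have "u \<in> pres_class S R v" by blast
  then have "pres_eq S R v u" by (simp add: pres_class_def)
  then show "pres_eq S R u v" by (rule pres_eq.sym)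
qed (rule pres_class_eqI)

lemma presented_group_mult_class:
  assumes "u \<in> words_over S" "v \<in> words_over S"
  shows "pres_class S R u \<otimes>\<^bsub>presented_group S R\<^esub> pres_class S R v = pres_class S R (u @ v)"
proof -
  have "pres_class S R (u' @ v') = pres_class S R (u @ v)"
    if "u' \<in> pres_class S R u" "v' \<in> pres_class S R v" for u' v'
  proof -
    have "pres_eq S R u u'" "pres_eq S R v v'" using that by (simp_all add: pres_class_def)
    from pres_class_eqI[OF pres_eq.cong[OF this]] show ?thesis by simp
  qed
  then have "(\<Union>u'\<in>pres_class S R u. \<Union>v'\<in>pres_class S R v. pres_class S R (u' @ v')) =
      (\<Union>u'\<in>pres_class S R u. \<Union>v'\<in>pres_class S R v. pres_class S R (u @ v))"
    by (intro SUP_cong) blast+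
  also have "\<dots> = pres_class S R (u @ v)"
    using pres_class_self[OF assms(1), of R] pres_class_self[OF assms(2), of R] by blast
  finally show ?thesis by (simp add: presented_group_def)
qed

lemma pres_eq_inverse:
  "w \<in> words_over S \<Longrightarrow> pres_eq S R (rev (map (\<lambda>(x, b). (x, \<not> b)) w) @ w) []"
proof (induction w)
  case Nil
  then show ?case by (simp add: pres_eq.refl)
next
  case (Cons l w)
  obtain x b where l: "l = (x, b)" by (cases l)
  let ?w' = "rev (map (\<lambda>(x, b). (x, \<not> b)) w)"
  have w: "w \<in> words_over S" "x \<in> S" using Cons.prems l by auto
  have IH: "pres_eq S R (?w' @ w) []" using Cons.IH w by simp
  then have w': "?w' \<in> words_over S" using pres_eq_words by fastforce
  have "pres_eq S R ([(x, \<not> b), (x, b)] @ w) ([] @ w)"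
    using pres_eq.cong[OF pres_eq.cancel[OF w(2), of R "\<not> b"] pres_eq.refl[OF w(1), of R]] by simp
  then have "pres_eq S R (?w' @ ([(x, \<not> b), (x, b)] @ w)) (?w' @ ([] @ w))"
    by (rule pres_eq.cong[OF pres_eq.refl[OF w']])
  then have "pres_eq S R (?w' @ ([(x, \<not> b), (x, b)] @ w)) []"
    using IH unfolding append_Nil by (rule pres_eq.trans)
  then show ?case by (simp add: l)
qed

lemma group_presented_group: "group (presented_group S R)"
proof (rule groupI)
  let ?G = "presented_group S R"
  have class_carr: "pres_class S R w \<in> carrier ?G" if "w \<in> words_over S" for w
    using that by (simp add: presented_group_def)
  have carrE: "\<exists>w. w \<in> words_over S \<and> X = pres_class S R w" if "X \<in> carrier ?G" for X
    using that unfolding presented_group_def by auto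
  have one: "\<one>\<^bsub>?G\<^esub> = pres_class S R []" by (simp add: presented_group_def)
  note m = presented_group_mult_class
  show "\<one>\<^bsub>?G\<^esub> \<in> carrier ?G" by (simp add: one class_carr)
  show "X \<otimes>\<^bsub>?G\<^esub> Y \<in> carrier ?G" if X: "X \<in> carrier ?G" and Y: "Y \<in> carrier ?G" for X Y
  proof -
    obtain u where u: "u \<in> words_over S" "X = pres_class S R u" using carrE[OF X] by blast
    obtain v where v: "v \<in> words_over S" "Y = pres_class S R v" using carrE[OF Y] by blast
    show ?thesis using u v by (simp add: m class_carr)
  qed
  show "X \<otimes>\<^bsub>?G\<^esub> Y \<otimes>\<^bsub>?G\<^esub> Z = X \<otimes>\<^bsub>?G\<^esub> (Y \<otimes>\<^bsub>?G\<^esub> Z)"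
    if X: "X \<in> carrier ?G" and Y: "Y \<in> carrier ?G" and Z: "Z \<in> carrier ?G" for X Y Z
  proof -
    obtain u where u: "u \<in> words_over S" "X = pres_class S R u" using carrE[OF X] by blast
    obtain v where v: "v \<in> words_over S" "Y = pres_class S R v" using carrE[OF Y] by blast
    obtain w where w: "w \<in> words_over S" "Z = pres_class S R w" using carrE[OF Z] by blast
    show ?thesis using u v w by (simp add: m)
  qed
  show "\<one>\<^bsub>?G\<^esub> \<otimes>\<^bsub>?G\<^esub> X = X" if X: "X \<in> carrier ?G" for X
  proof -
    obtain u where u: "u \<in> words_over S" "X = pres_class S R u" using carrE[OF X] by blast
    show ?thesis using u by (simp add: m one)
  qed
  show "\<exists>Y\<in>carrier ?G. Y \<otimes>\<^bsub>?G\<^esub> X = \<one>\<^bsub>?G\<^esub>" if X: "X \<in> carrier ?G" for X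
  proof -
    obtain w where w: "w \<in> words_over S" "X = pres_class S R w" using carrE[OF X] by blast
    let ?w' = "rev (map (\<lambda>(x, b). (x, \<not> b)) w)"
    have e: "pres_eq S R (?w' @ w) []" by (rule pres_eq_inverse[OF w(1)])
    then have w': "?w' \<in> words_over S" using pres_eq_words words_over_simps(3) by blast
    have "pres_class S R ?w' \<otimes>\<^bsub>?G\<^esub> X = \<one>\<^bsub>?G\<^esub>"
      using pres_class_eqI[OF e] by (simp only: w(2) m[OF w' w(1)] one)
    with class_carr[OF w'] show ?thesis by (rule bexI[rotated])
  qed
qed

context group
begin

lemma word_eval_closed:
  assumes "f \<in> S \<rightarrow> carrier G" "w \<in> words_over S"
  shows "word_eval G f w \<in> carrier G"
  using assms(2) by (induction w) (use assms(1) in \<open>auto simp: Pi_iff\<close>)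

lemma word_eval_append:
  assumes "f \<in> S \<rightarrow> carrier G" "u \<in> words_over S" "v \<in> words_over S"
  shows "word_eval G f (u @ v) = word_eval G f u \<otimes> word_eval G f v"
  using assms(2)
proof (induction u)
  case Nil
  then show ?case using word_eval_closed[OF assms(1,3)] by simp
next
  case (Cons l u)
  then have "f (fst l) \<in> carrier G" "word_eval G f u \<in> carrier G"
    using assms(1) word_eval_closed[OF assms(1)] by (auto simp: Pi_iff)
  with Cons show ?case using word_eval_closed[OF assms(1,3)] by (auto simp: m_assoc)
qed

lemma word_eval_cong:
  assumes f: "f \<in> S \<rightarrow> carrier G"
    and R: "\<And>u v. (u, v) \<in> R \<Longrightarrow> word_eval G f u = word_eval G f v"
    and "pres_eq S R u v"
  shows "word_eval G f u = word_eval G f v"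
  using assms(3)
proof (induction rule: pres_eq.induct)
  case (cong u u' v v')
  then show ?case using pres_eq_words by (metis word_eval_append[OF f])
next
  case (cancel x b)
  then have "f x \<in> carrier G" using f by auto
  then show ?case by auto
qed (auto simp: R)

lemma presented_hom_class:
  assumes f: "f \<in> S \<rightarrow> carrier G"
    and R: "\<And>u v. (u, v) \<in> R \<Longrightarrow> word_eval G f u = word_eval G f v"
    and w: "w \<in> words_over S"
  shows "presented_hom G f (pres_class S R w) = word_eval G f w"
proof -
  have "word_eval G f ` pres_class S R w = {word_eval G f w}"
  proof -
    have "word_eval G f v = word_eval G f w" if "v \<in> pres_class S R w" for v
    proof -
      have "pres_eq S R w v" using that by (simp add: pres_class_def)
      from word_eval_cong[OF f R this] show ?thesis by simp
    qed
    with pres_class_self[OF w, of R] show ?thesis by blast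
  qed
  then show ?thesis by (simp add: presented_hom_def)
qed

lemma presented_hom_hom:
  assumes f: "f \<in> S \<rightarrow> carrier G"
    and R: "\<And>u v. (u, v) \<in> R \<Longrightarrow> word_eval G f u = word_eval G f v"
  shows "presented_hom G f \<in> hom (presented_group S R) G"
proof (rule homI)
  have carr: "X \<in> carrier (presented_group S R) \<longleftrightarrow> (\<exists>w\<in>words_over S. X = pres_class S R w)" for X
    by (auto simp: presented_group_def)
  note h = presented_hom_class[OF f R]
  show "presented_hom G f X \<in> carrier G" if "X \<in> carrier (presented_group S R)" for X
    using that by (auto simp: carr h word_eval_closed[OF f])
  show "presented_hom G f (X \<otimes>\<^bsub>presented_group S R\<^esub> Y) = presented_hom G f X \<otimes> presented_hom G f Y"
    if "X \<in> carrier (presented_group S R)" "Y \<in> carrier (presented_group S R)" for X Y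
    using that by (auto simp: carr h presented_group_mult_class word_eval_append[OF f])
qed

end

section \<open>Braid groups and pure braid groups\<close>

definition braid_rels :: "nat \<Rightarrow> (nat word \<times> nat word) set"
  where "braid_rels n =
    {([pos i, pos j], [pos j, pos i]) | i j.
       i \<in> {1..n} \<and> j \<in> {1..n} \<and> (i + 2 \<le> j \<or> j + 2 \<le> i)} \<union>
    {([pos i, pos (i + 1), pos i], [pos (i + 1), pos i, pos (i + 1)]) | i.
       1 \<le> i \<and> i + 1 \<le> n}"

text \<open>\<open>braid_group n\<close> is the braid group on \<open>n + 1\<close> strands, i.e. the Artin group of type \<open>A\<close> and
  rank \<open>n\<close>.\<close>

definition braid_group :: "nat \<Rightarrow> nat word set monoid"
  where "braid_group n = presented_group {1..n} (braid_rels n)"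

definition braid_perm :: "nat \<Rightarrow> nat word set \<Rightarrow> nat \<Rightarrow> nat"
  where "braid_perm n = presented_hom (sym_group (n + 1)) (\<lambda>i. transpose i (i + 1))"

definition pure_braid_group :: "nat \<Rightarrow> nat word set monoid"
  where "pure_braid_group n =
    (braid_group n)\<lparr>carrier := kernel (braid_group n) (sym_group (n + 1)) (braid_perm n)\<rparr>"

lemma transpose_braid_relations:
  fixes i j :: nat
  shows "i + 2 \<le> j \<Longrightarrow>
      transpose i (i + 1) \<circ> transpose j (j + 1) = transpose j (j + 1) \<circ> transpose i (i + 1)"
    and "transpose i (i + 1) \<circ> (transpose (i + 1) (i + 1 + 1) \<circ> transpose i (i + 1)) =
      transpose (i + 1) (i + 1 + 1) \<circ> (transpose i (i + 1) \<circ> transpose (i + 1) (i + 1 + 1))"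
  by (auto simp: fun_eq_iff transpose_def)

lemma braid_perm_assignment:
  "(\<lambda>i. transpose i (i + 1)) \<in> {1..n} \<rightarrow> carrier (sym_group (n + 1))"
  by (auto simp: sym_group_def intro!: permutes_swap_id)

lemma braid_perm_respects:
  assumes "(u, v) \<in> braid_rels n"
  shows "word_eval (sym_group (n + 1)) (\<lambda>i. transpose i (i + 1)) u =
    word_eval (sym_group (n + 1)) (\<lambda>i. transpose i (i + 1)) v"
proof -
  consider i j where "u = [pos i, pos j]" "v = [pos j, pos i]" "i + 2 \<le> j \<or> j + 2 \<le> i"
    | i where "u = [pos i, pos (i + 1), pos i]" "v = [pos (i + 1), pos i, pos (i + 1)]"
    using assms unfolding braid_rels_def by blast
  then show ?thesis
  proof cases
    case (1 i j)
    then have "transpose i (i + 1) \<circ> transpose j (j + 1) = transpose j (j + 1) \<circ> transpose i (i + 1)"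
      using transpose_braid_relations(1)[of i j] transpose_braid_relations(1)[of j i] by metis
    with 1 show ?thesis by (simp add: sym_group_mult sym_group_one)
  next
    case (2 i)
    then show ?thesis
      using transpose_braid_relations(2)[of i] by (simp add: sym_group_mult sym_group_one)
  qed
qed

lemma braid_perm_hom: "braid_perm n \<in> hom (braid_group n) (sym_group (n + 1))"
  unfolding braid_perm_def braid_group_def
  by (rule group.presented_hom_hom[OF sym_group_is_group braid_perm_assignment braid_perm_respects])

lemma braid_perm_generator:
  assumes "i \<in> {1..n}"
  shows "braid_perm n (pres_class {1..n} (braid_rels n) [pos i]) = transpose i (i + 1)"
  unfolding braid_perm_def
  using assms
  by (subst group.presented_hom_class[OF sym_group_is_group braid_perm_assignment braid_perm_respects])
    (simp_all add: sym_group_mult sym_group_one)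

text \<open>The word of the product of the blocks \<open>s_m s_(m-1) ... s_i\<close> for \<open>m = i, ..., j\<close>.\<close>

definition ell_word :: "nat \<Rightarrow> nat \<Rightarrow> nat word"
  where "ell_word i j = concat (map (\<lambda>m. map pos (rev [i..<m + 1])) [i..<j + 1])"

definition ell :: "nat \<Rightarrow> nat \<Rightarrow> nat \<Rightarrow> nat word set"
  where "ell n i j = pres_class {1..n} (braid_rels n) (ell_word i j)"

text \<open>A pair \<open>(i, j)\<close> with \<open>i < j\<close> encodes the connected subset \<open>{i..j - 1}\<close> of the path graph,
  whence the shift by one in the second index.\<close>

definition zeta :: "nat \<Rightarrow> nat \<times> nat \<Rightarrow> nat word set"
  where "zeta n = (\<lambda>(i, j). ell n i (j - 1) [^]\<^bsub>braid_group n\<^esub> (2::nat))"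

definition pure_gens :: "nat \<Rightarrow> (nat \<times> nat) set"
  where "pure_gens n = {(i, j). 1 \<le> i \<and> i < j \<and> j \<le> n + 1}"

definition pure_rels :: "nat \<Rightarrow> ((nat \<times> nat) word \<times> (nat \<times> nat) word) set"
  where "pure_rels n =
    {([pos (i, j), pos (k, l)], [pos (k, l), pos (i, j)]) | i j k l.
       (i, j) \<in> pure_gens n \<and> (k, l) \<in> pure_gens n \<and>
       (j + 1 \<le> k \<or> (k \<le> i \<and> i \<le> j \<and> j \<le> l) \<or> (i \<le> k \<and> k \<le> l \<and> l \<le> j))} \<union>
    {([neg (i, y), pos (i, j), pos (x, y), pos (j + 1, k), neg (x, k)],
      [neg (x, k), pos (j + 1, k), pos (x, y), pos (i, j), neg (i, y)]) | i x j y k.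
       1 \<le> i \<and> i < x \<and> x \<le> j \<and> j < y \<and> y < k \<and> k \<le> n + 1}"

end

theory Submission
  imports Defs "HOL-Algebra.Bij"
begin

text \<open>Let \<open>D i j = s_(j-1) ... s_i s_i ... s_(j-1)\<close> be the braid in which strand \<open>j\<close> encircles the strands
  \<open>i, ..., j - 1\<close>. The full twist is \<open>z i j = D i (i+1) ... D i j\<close>, and everything is computed with the
  elements \<open>D\<close>. Given the commutation relations, relation (2) says that \<open>z x y (z i y)^-1 z i j\<close> commutes
  with products of elements \<open>(D x m)^-1 D (j+1) m\<close> for \<open>m > y\<close>, which follows from the case of single strands.

  For injectivity, induct on \<open>n\<close>. In the presented group, relation (2) with \<open>y = n\<close> and \<open>k = n + 1\<close> shows that
  the subgroup \<open>N\<close> generated by the elements \<open>d i = z i (n+1) (z i n)^-1\<close> is normalized by the generators not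
  involving strand \<open>n + 1\<close>, so every element is a product \<open>x h\<close> with \<open>x \<in> N\<close> and \<open>h\<close> in the image of
  the group of rank \<open>n - 1\<close>. For a group \<open>K\<close>, the disjoint union of \<open>K\<close> with conjugation and a
  second, marked copy of \<open>K\<close>, on which the first acts by left multiplication and which itself acts trivially, is a
  rack. The braid group acts on sequences in this rack by Hurwitz moves. If the last entry is a marked \<open>u\<close>, then
  \<open>d i\<close> only changes this entry, multiplying \<open>u\<close> by the product of the entries at \<open>i, ..., n\<close>. Hence if
  \<open>x h\<close> acts trivially then so does \<open>h\<close>, and \<open>h = 1\<close> by induction. Taking the presented group
  itself as \<open>K\<close>, with entries chosen such that the product from \<open>i\<close> to \<open>n\<close> is \<open>d i\<close>, the element
  \<open>x\<close> sends \<open>u\<close> to \<open>x u\<close>, and therefore \<open>x = 1\<close>.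

  For surjectivity, the subgroup generated by the \<open>D i j\<close> is normal and contains all \<open>s_i^2\<close>, so the
  normal forms of the symmetric group represent all its cosets, and these are told apart by their permutations.\<close>

section \<open>Commuting elements\<close>

context group
begin

definition commuting :: "'a \<Rightarrow> 'a \<Rightarrow> bool"
  where "commuting x y \<longleftrightarrow> x \<in> carrier G \<and> y \<in> carrier G \<and> x \<otimes> y = y \<otimes> x"

lemma commutingD:
  assumes "commuting x y"
  shows "x \<in> carrier G" "y \<in> carrier G" "x \<otimes> y = y \<otimes> x"
  using assms by (auto simp: commuting_def)

lemma commuting_sym: "commuting x y \<Longrightarrow> commuting y x"
  by (auto simp: commuting_def)

lemma commuting_refl: "x \<in> carrier G \<Longrightarrow> commuting x x"
  by (auto simp: commuting_def)

lemma commuting_one [simp]: "x \<in> carrier G \<Longrightarrow> commuting \<one> x" "x \<in> carrier G \<Longrightarrow> commuting x \<one>"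
  by (auto simp: commuting_def)

lemma inv_cancel_left [simp]:
  assumes "x \<in> carrier G" "y \<in> carrier G"
  shows "inv x \<otimes> (x \<otimes> y) = y" "x \<otimes> (inv x \<otimes> y) = y"
  using assms by (simp_all add: m_assoc [symmetric])

lemma commuting_mult:
  assumes "commuting x z" "commuting y z"
  shows "commuting (x \<otimes> y) z"
  using assms unfolding commuting_def by (metis m_assoc m_closed)

lemma commuting_inv:
  assumes "commuting x z"
  shows "commuting (inv x) z"
proof -
  note c = commutingD[OF assms]
  have "inv x \<otimes> z = inv x \<otimes> (z \<otimes> x) \<otimes> inv x"
    using c by (simp add: m_assoc del: c(3))
  also have "\<dots> = z \<otimes> inv x"
    using c(1,2) by (simp add: c(3)[symmetric] m_assoc)
  finally show ?thesis using c by (simp add: commuting_def)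
qed

lemma commuting_mult_right: "commuting z x \<Longrightarrow> commuting z y \<Longrightarrow> commuting z (x \<otimes> y)"
  by (meson commuting_mult commuting_sym)

lemma commuting_inv_right: "commuting z x \<Longrightarrow> commuting z (inv x)"
  by (meson commuting_inv commuting_sym)

lemmas commuting_intros = commuting_mult commuting_inv commuting_mult_right commuting_inv_right

lemma commuting_left_commute:
  assumes "commuting x y" "z \<in> carrier G"
  shows "x \<otimes> (y \<otimes> z) = y \<otimes> (x \<otimes> z)"
  using assms by (metis commutingD m_assoc)

end

section \<open>Full twists in a group satisfying the braid relations\<close>

text \<open>The indices are numbers of strands, and the value is one for \<open>j \<le> i\<close>,
  so that empty intervals need no separate treatment. The recursion peels off the topmost letter on
  both sides.\<close>

primrec loop :: "('a, 'm) monoid_scheme \<Rightarrow> (nat \<Rightarrow> 'a) \<Rightarrow> nat \<Rightarrow> nat \<Rightarrow> 'a"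
  where
    "loop G s i 0 = \<one>\<^bsub>G\<^esub>"
  | "loop G s i (Suc j) = (if i \<le> j then s j \<otimes>\<^bsub>G\<^esub> (loop G s i j \<otimes>\<^bsub>G\<^esub> s j) else \<one>\<^bsub>G\<^esub>)"

primrec full_twist :: "('a, 'm) monoid_scheme \<Rightarrow> (nat \<Rightarrow> 'a) \<Rightarrow> nat \<Rightarrow> nat \<Rightarrow> 'a"
  where
    "full_twist G s i 0 = \<one>\<^bsub>G\<^esub>"
  | "full_twist G s i (Suc j) = full_twist G s i j \<otimes>\<^bsub>G\<^esub> loop G s i (Suc j)"

locale braid_system = group G for G (structure) +
  fixes s :: "nat \<Rightarrow> 'a" and n :: nat
  assumes s_closed: "1 \<le> i \<Longrightarrow> i \<le> n \<Longrightarrow> s i \<in> carrier G"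
    and s_far: "1 \<le> i \<Longrightarrow> j \<le> n \<Longrightarrow> i + 2 \<le> j \<Longrightarrow> s i \<otimes> s j = s j \<otimes> s i"
    and s_braid: "1 \<le> i \<Longrightarrow> Suc i \<le> n \<Longrightarrow>
      s i \<otimes> (s (Suc i) \<otimes> s i) = s (Suc i) \<otimes> (s i \<otimes> s (Suc i))"
begin

abbreviation D where "D \<equiv> loop G s"
abbreviation Z where "Z \<equiv> full_twist G s"

lemma s_comm:
  assumes "1 \<le> i" "1 \<le> j" "i \<le> n" "j \<le> n" "i + 2 \<le> j \<or> j + 2 \<le> i"
  shows "commuting (s i) (s j)"
  using assms s_far[of i j] s_far[of j i] s_closed by (auto simp: commuting_def)

lemma D_triv [simp]: "j \<le> i \<Longrightarrow> D i j = \<one>"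
  by (cases j) auto

lemma D_Suc: "i \<le> j \<Longrightarrow> D i (Suc j) = s j \<otimes> (D i j \<otimes> s j)"
  by simp

lemma D_closed [simp]: "1 \<le> i \<Longrightarrow> j \<le> Suc n \<Longrightarrow> D i j \<in> carrier G"
  by (induction j) (auto simp: s_closed)

lemma Z_triv [simp]: "j \<le> i \<Longrightarrow> Z i j = \<one>"
  by (induction j) auto

lemma Z_closed [simp]: "1 \<le> i \<Longrightarrow> j \<le> Suc n \<Longrightarrow> Z i j \<in> carrier G"
proof (induction j)
  case (Suc j)
  then show ?case using D_closed[of i "Suc j"] by (simp del: loop.simps)
qed simp

lemma commuting_D:
  assumes "x \<in> carrier G" "1 \<le> i" "j \<le> Suc n" "\<And>m. i \<le> m \<Longrightarrow> m < j \<Longrightarrow> commuting x (s m)"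
  shows "commuting x (D i j)"
  using assms(3,4) by (induction j) (auto simp: assms(1) intro!: commuting_mult_right)

lemma commuting_Z:
  assumes "x \<in> carrier G" "1 \<le> i" "j \<le> Suc n" "\<And>m. i \<le> m \<Longrightarrow> m < j \<Longrightarrow> commuting x (s m)"
  shows "commuting x (Z i j)"
  using assms(3,4)
proof (induction j)
  case (Suc j)
  then have "commuting x (D i (Suc j))" by (intro commuting_D[OF assms(1,2)]) auto
  moreover have "commuting x (Z i j)" using Suc by simp
  ultimately show ?case by (simp add: commuting_mult_right del: loop.simps)
qed (simp add: assms)

lemma D_far:
  assumes "1 \<le> i" "j \<le> Suc n" "1 \<le> m" "m \<le> n" "m + 2 \<le> i \<or> j < m"
  shows "commuting (D i j) (s m)"
  using assms by (intro commuting_sym[OF commuting_D] s_comm s_closed) auto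

text \<open>For \<open>j > m + 2\<close> the outer letter \<open>s (j - 1)\<close> commutes with
  \<open>s m\<close>. The decisive case is \<open>j = m + 2\<close>: on its way through
  \<open>s (m + 1) s m D i m s m s (m + 1)\<close>, the letter \<open>s m\<close> becomes
  \<open>s (m + 1)\<close> by a braid relation, passes \<open>D i m\<close>, and becomes
  \<open>s m\<close> again.\<close>

lemma D_inner:
  assumes "1 \<le> i" "i \<le> m" "m + 2 \<le> j" "j \<le> Suc n"
  shows "commuting (D i j) (s m)"
  using assms(3,4)
proof (induction j)
  case (Suc j)
  show ?case
  proof (cases "m + 2 \<le> j")
    case True
    with Suc assms show ?thesis
      by (auto simp: D_Suc intro!: commuting_mult s_comm)
  next
    case False
    then have j: "j = Suc m" using Suc.prems by simp
    let ?a = "s m" and ?b = "s (Suc m)" and ?D = "D i m"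
    have cl: "?a \<in> carrier G" "?b \<in> carrier G" "?D \<in> carrier G"
      using assms Suc.prems j by (auto intro: s_closed)
    have c: "commuting ?D ?b" using assms Suc.prems j by (intro D_far) auto
    have br: "?a \<otimes> (?b \<otimes> ?a) = ?b \<otimes> (?a \<otimes> ?b)" using assms Suc.prems j by (intro s_braid) auto
    have br': "?a \<otimes> (?b \<otimes> (?a \<otimes> w)) = ?b \<otimes> (?a \<otimes> (?b \<otimes> w))" if "w \<in> carrier G" for w
    proof -
      have "?a \<otimes> (?b \<otimes> ?a) \<otimes> w = ?b \<otimes> (?a \<otimes> ?b) \<otimes> w" using br by simp
      then show ?thesis using cl that by (simp add: m_assoc)
    qed
    have "?a \<otimes> (?b \<otimes> (?a \<otimes> (?D \<otimes> (?a \<otimes> ?b)))) = ?b \<otimes> (?a \<otimes> (?b \<otimes> (?D \<otimes> (?a \<otimes> ?b))))"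
      using cl by (simp add: br')
    also have "\<dots> = ?b \<otimes> (?a \<otimes> (?D \<otimes> (?b \<otimes> (?a \<otimes> ?b))))"
      using cl commuting_left_commute[OF c, of "?a \<otimes> ?b"] by simp
    also have "\<dots> = ?b \<otimes> (?a \<otimes> (?D \<otimes> (?a \<otimes> (?b \<otimes> ?a))))" by (simp add: br)
    finally show ?thesis using cl assms by (simp add: j commuting_def m_assoc)
  qed
qed simp

lemma Z_far:
  assumes "1 \<le> i" "j \<le> Suc n" "1 \<le> m" "m \<le> n" "m + 2 \<le> i \<or> j < m"
  shows "commuting (Z i j) (s m)"
  using assms by (intro commuting_sym[OF commuting_Z] s_comm s_closed) auto

text \<open>Only the topmost letter \<open>s m\<close> is new in the induction step. The factors
  \<open>D i m\<close> and \<open>D i (m + 1) = s m D i m s m\<close> commute, and this relation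
  makes their product commute with \<open>s m\<close>; the remaining factor
  \<open>Z i (m - 1)\<close> does not reach the letters next to \<open>s m\<close>.\<close>

lemma Z_inner:
  assumes "1 \<le> i" "i \<le> m" "m < j" "j \<le> Suc n"
  shows "commuting (Z i j) (s m)"
  using assms(3,4)
proof (induction j)
  case (Suc j)
  show ?case
  proof (cases "m < j")
    case True
    with Suc assms have "commuting (D i (Suc j)) (s m)" by (intro D_inner) auto
    with Suc True show ?thesis by (auto simp del: loop.simps intro!: commuting_mult)
  next
    case False
    then have j: "j = m" using Suc.prems by simp
    show ?thesis
    proof (cases "i = m")
      case True
      have "s m \<in> carrier G" using assms Suc.prems j by (intro s_closed) auto
      then show ?thesis by (simp add: j True commuting_mult commuting_refl)
    next
      case False
      then obtain k where k: "m = Suc k" "i \<le> k" using assms by (cases m) auto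
      let ?s = "s m" and ?D = "D i m"
      have cl: "?s \<in> carrier G" "?D \<in> carrier G"
        using assms Suc.prems j by (auto intro: s_closed)
      have "commuting ?D (D i (Suc m))"
        using assms Suc.prems j
        by (intro commuting_sym[OF commuting_D] D_inner commuting_D[of "D i (Suc m)"] D_closed) auto
      then have c: "?D \<otimes> (?s \<otimes> (?D \<otimes> ?s)) = ?s \<otimes> (?D \<otimes> (?s \<otimes> ?D))"
        using assms cl by (simp add: commuting_def m_assoc)
      have "?s \<otimes> (?D \<otimes> (?s \<otimes> (?D \<otimes> ?s))) = ?s \<otimes> (?D \<otimes> (?s \<otimes> ?D)) \<otimes> ?s"
        using cl by (simp add: m_assoc)
      also have "\<dots> = ?D \<otimes> (?s \<otimes> (?D \<otimes> ?s)) \<otimes> ?s" by (simp add: c)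
      finally have "commuting (?D \<otimes> D i (Suc m)) ?s"
        using cl assms by (simp add: commuting_def m_assoc)
      moreover have "commuting (Z i k) ?s" using assms Suc.prems j k by (intro Z_far) auto
      moreover have "Z i (Suc j) = Z i k \<otimes> (?D \<otimes> D i (Suc m))"
        using assms Suc.prems j k by (simp add: m_assoc s_closed)
      ultimately show ?thesis by (simp add: commuting_mult del: full_twist.simps)
    qed
  qed
qed simp

section \<open>Relation (1) for full twists\<close>

lemma Z_disjoint:
  assumes "1 \<le> i" "j < k" "j \<le> Suc n" "l \<le> Suc n"
  shows "commuting (Z i j) (Z k l)"
  using assms by (intro commuting_Z Z_far) auto

lemma Z_nested:
  assumes "1 \<le> i" "i \<le> k" "l \<le> j" "j \<le> Suc n"
  shows "commuting (Z i j) (Z k l)"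
  using assms by (intro commuting_Z Z_inner) auto

end

section \<open>The relation for interlocked intervals\<close>

lemma (in group) commuting_conj:
  assumes "commuting g x" "commuting g y"
  shows "commuting g (x \<otimes> (y \<otimes> inv x))" "commuting g (inv x \<otimes> (y \<otimes> x))"
  using assms by (simp_all add: commuting_mult_right commuting_inv_right)

lemma (in group) conj_commuting:
  assumes "commuting x y" "a \<in> carrier G"
  shows "commuting (a \<otimes> (x \<otimes> inv a)) (a \<otimes> (y \<otimes> inv a))"
proof -
  note c = commutingD[OF assms(1)]
  have "x \<otimes> (y \<otimes> inv a) = y \<otimes> (x \<otimes> inv a)"
    using assms by (intro commuting_left_commute) auto
  then show ?thesis using c(1,2) assms(2) by (simp add: commuting_def m_assoc)
qed

context braid_system
begin

text \<open>Both telescope into the elements \<open>D\<close>. \<open>A p m\<close> and the inverse of \<open>F p m\<close> link only the strands \<open>p\<close>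
  and \<open>m\<close>; they pass the strands between on opposite sides, which is why \<open>A\<close> and \<open>F\<close> commute for crossing
  pairs.\<close>

abbreviation A where "A p m \<equiv> D p m \<otimes> inv (D (Suc p) m)"
abbreviation F where "F q m \<equiv> inv (D q m) \<otimes> D (Suc q) m"

lemma D_Z_nested:
  assumes "1 \<le> i" "i \<le> k" "l < j" "j \<le> Suc n"
  shows "commuting (D i j) (Z k l)"
  using assms by (intro commuting_Z D_inner D_closed) auto

lemma A_Suc:
  assumes "1 \<le> p" "p < m" "m \<le> n"
  shows "A p (Suc m) = s m \<otimes> (A p m \<otimes> inv (s m))"
proof -
  have "s m \<in> carrier G" "D p m \<in> carrier G" "D (Suc p) m \<in> carrier G"
    using assms by (auto intro: s_closed)
  then show ?thesis using assms by (simp add: m_assoc inv_mult_group)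
qed

lemma F_Suc:
  assumes "1 \<le> p" "p < m" "m \<le> n"
  shows "F p (Suc m) = inv (s m) \<otimes> (F p m \<otimes> s m)"
proof -
  have "s m \<in> carrier G" "D p m \<in> carrier G" "D (Suc p) m \<in> carrier G"
    using assms by (auto intro: s_closed)
  then show ?thesis using assms by (simp add: m_assoc inv_mult_group)
qed

text \<open>This rewrites \<open>F q (q + 2)\<close> as the inverse of the square of a conjugate by
  \<open>s q\<close>, the same conjugation that produces \<open>A p (q + 1)\<close> from
  \<open>A p q\<close>.\<close>

lemma braid_conj:
  assumes "1 \<le> i" "Suc i \<le> n"
  shows "inv (s (Suc i)) \<otimes> (s i \<otimes> s (Suc i)) = s i \<otimes> (s (Suc i) \<otimes> inv (s i))"
proof -
  have cl: "s i \<in> carrier G" "s (Suc i) \<in> carrier G" using assms by (auto intro: s_closed)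
  have "s i \<otimes> s (Suc i) = (s i \<otimes> (s (Suc i) \<otimes> s i)) \<otimes> inv (s i)" using cl by (simp add: m_assoc)
  also have "\<dots> = s (Suc i) \<otimes> (s i \<otimes> (s (Suc i) \<otimes> inv (s i)))"
    using cl s_braid[OF assms] by (simp add: m_assoc)
  finally show ?thesis using cl by simp
qed

text \<open>Raising \<open>k\<close> conjugates \<open>F q k\<close> by letters beyond strand
  \<open>m\<close>, which commute with \<open>A p m\<close>. So only the case
  \<open>k = m + 1\<close> remains.\<close>

lemma A_F_commute_up:
  assumes "commuting (A p m) (F q (Suc m))" "1 \<le> p" "1 \<le> q" "q < m" "m < k" "k \<le> Suc n"
  shows "commuting (A p m) (F q k)"
  using assms(5,6)
proof (induction k)
  case (Suc k)
  show ?case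
  proof (cases "m = k")
    case True
    with assms show ?thesis by simp
  next
    case False
    then have "commuting (D p m) (s k)" "commuting (D (Suc p) m) (s k)"
      using assms Suc.prems by (auto intro!: D_far)
    then have "commuting (A p m) (s k)" by (simp add: commuting_intros)
    moreover have "commuting (A p m) (F q k)" using Suc False by simp
    ultimately show ?thesis
      using Suc.prems assms False F_Suc[of q k] by (simp add: commuting_conj del: loop.simps)
  qed
qed simp

text \<open>With \<open>k = m + 1\<close>, raising \<open>m\<close> conjugates \<open>A p m\<close>
  by \<open>s m\<close>, which commutes with \<open>F q (m + 2)\<close> by \<open>D_inner\<close>.
  The induction starts at \<open>m = q + 1\<close> with a direct computation.\<close>

lemma A_F_commute:
  assumes "1 \<le> p" "p < q" "q < m" "m < k" "k \<le> Suc n"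
  shows "commuting (A p m) (F q k)"
proof -
  have "commuting (A p m) (F q (Suc m))" if "q < m" "m \<le> n" for m
    using that
  proof (induction m)
    case (Suc m)
    show ?case
    proof (cases "q = m")
      case True
      let ?a = "s q" and ?b = "s (Suc q)"
      let ?x = "?a \<otimes> (?b \<otimes> inv ?a)"
      have cl: "?a \<in> carrier G" "?b \<in> carrier G"
        using assms Suc.prems True by (auto intro!: s_closed)
      have "F q (Suc (Suc q)) = inv (inv ?b \<otimes> (?a \<otimes> ?b) \<otimes> (inv ?b \<otimes> (?a \<otimes> ?b)))"
        using cl by (simp add: m_assoc inv_mult_group)
      also have "\<dots> = inv (?x \<otimes> ?x)"
        using assms Suc.prems True by (simp only: braid_conj)
      finally have F: "F q (Suc (Suc q)) = inv (?x \<otimes> ?x)" .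
      have "commuting (D p q) ?b" "commuting (D (Suc p) q) ?b"
        using assms Suc.prems True by (auto intro!: D_far)
      then have "commuting (A p q) ?b" by (simp add: commuting_intros)
      \<comment> \<open>Conjugation by \<open>?a\<close> takes the commuting elements
        \<open>A p q\<close> and \<open>?b\<close> to \<open>A p (q + 1)\<close> and
        \<open>?x\<close>.\<close>
      then have "commuting (?a \<otimes> (A p q \<otimes> inv ?a)) ?x"
        using cl by (intro conj_commuting)
      then have "commuting (A p (Suc q)) ?x"
        using A_Suc[of p q] assms Suc.prems True by (simp del: loop.simps)
      then show ?thesis
        unfolding True[symmetric] F by (blast intro: commuting_inv_right commuting_mult_right)
    next
      case False
      then have m: "q < m" using Suc.prems by simp
      have "commuting (F q (Suc (Suc m))) (A p m)"
        using m assms Suc A_F_commute_up[of p m q "Suc (Suc m)"]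
        by (simp add: commuting_sym del: loop.simps)
      moreover have "commuting (D q (Suc (Suc m))) (s m)" "commuting (D (Suc q) (Suc (Suc m))) (s m)"
        using m assms Suc.prems by (auto intro!: D_inner simp del: loop.simps)
      then have "commuting (F q (Suc (Suc m))) (s m)" by (intro commuting_intros)
      ultimately have "commuting (F q (Suc (Suc m))) (s m \<otimes> (A p m \<otimes> inv (s m)))"
        by (intro commuting_conj)
      then show ?thesis
        using m assms Suc.prems A_Suc[of p m] by (simp add: commuting_sym del: loop.simps)
    qed
  qed simp
  then show ?thesis using assms A_F_commute_up[of p m q k] by simp
qed

lemma commuting_telescope_A:
  assumes "1 \<le> i" "i \<le> x" "m \<le> Suc n" "g \<in> carrier G"
    and "\<And>p. i \<le> p \<Longrightarrow> p < x \<Longrightarrow> commuting g (A p m)"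
  shows "commuting g (D i m \<otimes> inv (D x m))"
  using assms(2,5)
proof (induction x rule: dec_induct)
  case base
  then show ?case using assms by simp
next
  case (step x)
  have "D i m \<otimes> inv (D (Suc x) m) = (D i m \<otimes> inv (D x m)) \<otimes> A x m"
    using assms step by (simp add: m_assoc)
  with step show ?case by (simp add: commuting_mult_right)
qed

lemma commuting_telescope_F:
  assumes "1 \<le> i" "i \<le> x" "m \<le> Suc n" "g \<in> carrier G"
    and "\<And>p. i \<le> p \<Longrightarrow> p < x \<Longrightarrow> commuting g (F p m)"
  shows "commuting g (inv (D i m) \<otimes> D x m)"
  using assms(2,5)
proof (induction x rule: dec_induct)
  case base
  then show ?case using assms by simp
next
  case (step x)
  have "inv (D i m) \<otimes> D (Suc x) m = (inv (D i m) \<otimes> D x m) \<otimes> F x m"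
    using assms step by (simp add: m_assoc)
  with step show ?case by (simp add: commuting_mult_right)
qed

text \<open>The first element telescopes into the \<open>F q k\<close> with
  \<open>x \<le> q \<le> j\<close>, the second into the inverses of the \<open>A p m\<close> with
  \<open>i \<le> p < x\<close>. All pairs satisfy \<open>p < q < m < k\<close>, so
  \<open>A_F_commute\<close> applies.\<close>

lemma commuting_blocks:
  assumes "1 \<le> i" "i < x" "x \<le> j" "j < m" "m < k" "k \<le> Suc n"
  shows "commuting (inv (D x k) \<otimes> D (Suc j) k) (D x m \<otimes> inv (D i m))"
proof -
  have *: "commuting (inv (D x k) \<otimes> D (Suc j) k) (A p m)" if "i \<le> p" "p < x" for p
    using assms that
    by (intro commuting_sym[OF commuting_telescope_F] A_F_commute m_closed inv_closed D_closed) auto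
  have "commuting (inv (D x k) \<otimes> D (Suc j) k) (inv (D i m \<otimes> inv (D x m)))"
    using assms by (intro commuting_inv_right[OF commuting_telescope_A[OF _ _ _ _ *]]) auto
  then show ?thesis using assms by (simp add: inv_mult_group)
qed

text \<open>The second element is \<open>Z x j\<close> for \<open>y = j\<close>, and each increase
  of \<open>y\<close> puts one block of the kind treated in \<open>commuting_blocks\<close> in front
  of it.\<close>

lemma commuting_left_blocks:
  assumes "1 \<le> i" "i < x" "x \<le> j" "j \<le> y" "y < k" "k \<le> Suc n"
  shows "commuting (inv (D x k) \<otimes> D (Suc j) k) (Z x y \<otimes> (inv (Z i y) \<otimes> Z i j))"
  using \<open>j \<le> y\<close> \<open>y < k\<close>
proof (induction y rule: dec_induct)
  case base
  have "commuting (D x k) (Z x j)" using assms by (intro D_Z_nested) auto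
  moreover have "commuting (D (Suc j) k) (Z x j)" using assms by (intro commuting_Z D_far D_closed) auto
  ultimately show ?case using assms by (simp add: commuting_intros)
next
  case (step y)
  let ?G = "D x (Suc y) \<otimes> inv (D i (Suc y))"
  have cl: "D x (Suc y) \<in> carrier G" "D i (Suc y) \<in> carrier G" "Z x y \<in> carrier G" "Z i y \<in> carrier G"
    "Z i j \<in> carrier G"
    using step assms by (auto simp del: loop.simps)
  have "commuting (D x (Suc y)) (Z x y)" "commuting (D i (Suc y)) (Z x y)"
    using step assms by (auto intro!: D_Z_nested simp del: loop.simps)
  then have c: "commuting ?G (Z x y)" by (intro commuting_intros)
  have "Z x (Suc y) \<otimes> (inv (Z i (Suc y)) \<otimes> Z i j) = Z x y \<otimes> (?G \<otimes> (inv (Z i y) \<otimes> Z i j))"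
    using cl by (simp add: m_assoc inv_mult_group del: loop.simps)
  also have "\<dots> = ?G \<otimes> (Z x y \<otimes> (inv (Z i y) \<otimes> Z i j))"
    using cl by (intro commuting_left_commute[symmetric] c) auto
  finally have eq: "Z x (Suc y) \<otimes> (inv (Z i (Suc y)) \<otimes> Z i j) = \<dots>" .
  have "commuting (inv (D x k) \<otimes> D (Suc j) k) ?G"
    using step assms by (intro commuting_blocks) auto
  moreover have "commuting (inv (D x k) \<otimes> D (Suc j) k) (Z x y \<otimes> (inv (Z i y) \<otimes> Z i j))"
    using step by simp
  ultimately show ?case
    unfolding eq by (rule commuting_mult_right)
qed

text \<open>The first element is the identity for \<open>k = y\<close>, and each increase of
  \<open>k\<close> appends on the right one factor to which \<open>commuting_left_blocks\<close>
  applies.\<close>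

lemma commuting_right_blocks:
  assumes "1 \<le> i" "i < x" "x \<le> j" "j < y" "y \<le> k" "k \<le> Suc n"
  shows "commuting (inv (Z (Suc j) y) \<otimes> (Z x y \<otimes> (inv (Z x k) \<otimes> Z (Suc j) k)))
    (Z x y \<otimes> (inv (Z i y) \<otimes> Z i j))"
  using \<open>y \<le> k\<close> \<open>k \<le> Suc n\<close>
proof (induction k rule: dec_induct)
  case base
  then show ?case using assms by simp
next
  case (step k)
  let ?E = "inv (D x (Suc k)) \<otimes> D (Suc j) (Suc k)"
  have cl: "D x (Suc k) \<in> carrier G" "D (Suc j) (Suc k) \<in> carrier G" "Z x y \<in> carrier G"
    "Z x k \<in> carrier G" "Z (Suc j) k \<in> carrier G" "Z (Suc j) y \<in> carrier G"
    using step assms by (auto simp del: loop.simps)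
  have "commuting (D x (Suc k)) (Z x k)" "commuting (D x (Suc k)) (Z (Suc j) k)"
    using step assms by (auto intro!: D_Z_nested simp del: loop.simps)
  then have c: "commuting (inv (D x (Suc k))) (inv (Z x k) \<otimes> Z (Suc j) k)" by (intro commuting_intros)
  have "inv (Z x (Suc k)) \<otimes> Z (Suc j) (Suc k) =
      inv (D x (Suc k)) \<otimes> (inv (Z x k) \<otimes> Z (Suc j) k) \<otimes> D (Suc j) (Suc k)"
    using cl by (simp add: m_assoc inv_mult_group del: loop.simps)
  also have "\<dots> = (inv (Z x k) \<otimes> Z (Suc j) k) \<otimes> ?E"
    using cl by (simp add: commutingD(3)[OF c] m_assoc del: loop.simps)
  finally have "inv (Z (Suc j) y) \<otimes> (Z x y \<otimes> (inv (Z x (Suc k)) \<otimes> Z (Suc j) (Suc k))) =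
      (inv (Z (Suc j) y) \<otimes> (Z x y \<otimes> (inv (Z x k) \<otimes> Z (Suc j) k))) \<otimes> ?E"
    using cl by (simp add: m_assoc del: loop.simps full_twist.simps)
  moreover have "commuting ?E (Z x y \<otimes> (inv (Z i y) \<otimes> Z i j))"
    using step assms by (intro commuting_left_blocks) auto
  ultimately show ?case
    using step by (auto intro: commuting_mult simp del: loop.simps full_twist.simps)
qed

lemma Z_interlocked:
  assumes "1 \<le> i" "i < x" "x \<le> j" "j < y" "y < k" "k \<le> Suc n"
  shows "inv (Z i y) \<otimes> (Z i j \<otimes> (Z x y \<otimes> (Z (Suc j) k \<otimes> inv (Z x k)))) =
    inv (Z x k) \<otimes> (Z (Suc j) k \<otimes> (Z x y \<otimes> (Z i j \<otimes> inv (Z i y))))"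
proof -
  let ?P = "inv (Z i y) \<otimes> Z i j" and ?Q = "inv (Z x k) \<otimes> Z (Suc j) k"
  let ?C = "Z (Suc j) y"
  \<comment> \<open>As \<open>?C\<close> commutes with \<open>?P\<close> and with
    \<open>Z x y\<close>, the claim that \<open>?P\<close>, \<open>Z x y\<close>, \<open>?Q\<close>
    have the same product in reverse order becomes the commutation of \<open>?V\<close> with
    \<open>?R\<close>.\<close>
  let ?V = "inv ?C \<otimes> (Z x y \<otimes> ?Q)" and ?R = "Z x y \<otimes> ?P"
  have cl: "Z i y \<in> carrier G" "Z i j \<in> carrier G" "Z x y \<in> carrier G" "Z x k \<in> carrier G"
    "Z (Suc j) k \<in> carrier G" "?C \<in> carrier G"
    using assms by auto
  have VR: "commuting ?V ?R" using assms by (intro commuting_right_blocks) auto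
  have "commuting (Z i y) ?C" using assms by (intro Z_nested) auto
  moreover have "commuting (Z i j) ?C" using assms by (intro Z_disjoint) auto
  ultimately have PC: "commuting ?P ?C" by (intro commuting_intros)
  have BC: "commuting (Z x y) ?C" "commuting (Z x k) (Z (Suc j) k)" "commuting (Z i y) (Z i j)"
    using assms by (auto intro!: Z_nested)
  have Q: "Z (Suc j) k \<otimes> inv (Z x k) = ?Q"
    using commutingD(3)[OF commuting_inv[OF BC(2)]] by simp
  have P: "Z i j \<otimes> inv (Z i y) = ?P"
    using commutingD(3)[OF commuting_inv[OF BC(3)]] by simp
  have "?P \<otimes> (Z x y \<otimes> ?Q) = ?P \<otimes> (?C \<otimes> ?V)" using cl by (simp add: m_assoc)
  also have "\<dots> = ?C \<otimes> (?P \<otimes> ?V)" using cl PC by (intro commuting_left_commute) auto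
  also have "\<dots> = ?C \<otimes> (inv (Z x y) \<otimes> (?R \<otimes> ?V))" using cl by (simp add: m_assoc)
  also have "\<dots> = ?C \<otimes> (inv (Z x y) \<otimes> (?V \<otimes> ?R))" using commutingD(3)[OF VR] by simp
  also have "\<dots> = inv (Z x y) \<otimes> (?C \<otimes> (?V \<otimes> ?R))"
    using cl commuting_inv[OF BC(1)] by (intro commuting_left_commute[symmetric]) auto
  also have "\<dots> = ?Q \<otimes> (Z x y \<otimes> ?P)" using cl by (simp add: m_assoc)
  finally show ?thesis unfolding Q P using cl by (simp add: m_assoc)
qed


end

section \<open>Squares of half twists\<close>

primrec descend :: "('a, 'm) monoid_scheme \<Rightarrow> (nat \<Rightarrow> 'a) \<Rightarrow> nat \<Rightarrow> nat \<Rightarrow> 'a"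
  where
    "descend G s i 0 = \<one>\<^bsub>G\<^esub>"
  | "descend G s i (Suc j) = (if i \<le> j then s j \<otimes>\<^bsub>G\<^esub> descend G s i j else \<one>\<^bsub>G\<^esub>)"

primrec ascend :: "('a, 'm) monoid_scheme \<Rightarrow> (nat \<Rightarrow> 'a) \<Rightarrow> nat \<Rightarrow> nat \<Rightarrow> 'a"
  where
    "ascend G s i 0 = \<one>\<^bsub>G\<^esub>"
  | "ascend G s i (Suc j) = (if i \<le> j then ascend G s i j \<otimes>\<^bsub>G\<^esub> s j else \<one>\<^bsub>G\<^esub>)"

primrec half_twist :: "('a, 'm) monoid_scheme \<Rightarrow> (nat \<Rightarrow> 'a) \<Rightarrow> nat \<Rightarrow> nat \<Rightarrow> 'a"
  where
    "half_twist G s i 0 = \<one>\<^bsub>G\<^esub>"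
  | "half_twist G s i (Suc j) = half_twist G s i j \<otimes>\<^bsub>G\<^esub> descend G s i (Suc j)"

context braid_system
begin

abbreviation desc where "desc \<equiv> descend G s"
abbreviation asc where "asc \<equiv> ascend G s"
abbreviation H where "H \<equiv> half_twist G s"

lemma desc_triv [simp]: "j \<le> i \<Longrightarrow> desc i j = \<one>"
  by (cases j) auto

lemma asc_triv [simp]: "j \<le> i \<Longrightarrow> asc i j = \<one>"
  by (cases j) auto

lemma H_triv [simp]: "j \<le> i \<Longrightarrow> H i j = \<one>"
  by (induction j) auto

lemma desc_closed [simp]: "1 \<le> i \<Longrightarrow> j \<le> Suc n \<Longrightarrow> desc i j \<in> carrier G"
  by (induction j) (auto simp: s_closed)

lemma asc_closed [simp]: "1 \<le> i \<Longrightarrow> j \<le> Suc n \<Longrightarrow> asc i j \<in> carrier G"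
  by (induction j) (auto simp: s_closed)

lemma H_closed [simp]: "1 \<le> i \<Longrightarrow> j \<le> Suc n \<Longrightarrow> H i j \<in> carrier G"
proof (induction j)
  case (Suc j)
  then show ?case using desc_closed[of i "Suc j"] by (simp del: descend.simps)
qed simp

lemma desc_asc: "1 \<le> i \<Longrightarrow> j \<le> Suc n \<Longrightarrow> desc i j \<otimes> asc i j = D i j"
proof (induction j)
  case (Suc j)
  show ?case
  proof (cases "i \<le> j")
    case True
    then have cl: "s j \<in> carrier G" "desc i j \<in> carrier G" "asc i j \<in> carrier G"
      using Suc.prems by (auto intro: s_closed)
    have "desc i (Suc j) \<otimes> asc i (Suc j) = s j \<otimes> (desc i j \<otimes> asc i j \<otimes> s j)"
      using cl True by (simp add: m_assoc)
    then show ?thesis using Suc True by simp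
  qed simp
qed simp

lemma commuting_desc:
  assumes "x \<in> carrier G" "1 \<le> i" "j \<le> Suc n" "\<And>m. i \<le> m \<Longrightarrow> m < j \<Longrightarrow> commuting x (s m)"
  shows "commuting x (desc i j)"
  using assms(3,4) by (induction j) (auto simp: assms(1) intro!: commuting_mult_right)

lemma commuting_H:
  assumes "x \<in> carrier G" "1 \<le> i" "j \<le> Suc n" "\<And>m. i \<le> m \<Longrightarrow> m < j \<Longrightarrow> commuting x (s m)"
  shows "commuting x (H i j)"
  using assms(3,4)
proof (induction j)
  case (Suc j)
  then have "commuting x (desc i (Suc j))" by (intro commuting_desc[OF assms(1,2)]) auto
  moreover have "commuting x (H i j)" using Suc by simp
  ultimately show ?case by (simp add: commuting_mult_right del: descend.simps)
qed (simp add: assms)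

text \<open>This gives a second recursion for \<open>H i (j + 1)\<close>, with the new block on the
  left. In the induction the new letter \<open>s (j + 1)\<close> commutes with
  \<open>H i j\<close>.\<close>

lemma H_desc:
  assumes "1 \<le> i" "i \<le> j" "j \<le> n"
  shows "H i j \<otimes> desc i (Suc j) = asc i (Suc j) \<otimes> H i j"
  using assms(2,3)
proof (induction j rule: dec_induct)
  case base
  then show ?case using assms by (simp add: s_closed)
next
  case (step j)
  let ?s = "s (Suc j)" and ?c = "desc i (Suc j)"
  have cl: "?s \<in> carrier G" "?c \<in> carrier G" "asc i (Suc j) \<in> carrier G" "H i j \<in> carrier G"
    using step assms by (auto intro: s_closed simp del: descend.simps ascend.simps)
  have "commuting ?s (H i j)"
    using step assms by (intro commuting_H s_comm s_closed) auto
  then have c: "H i j \<otimes> (?s \<otimes> ?c) = ?s \<otimes> (H i j \<otimes> ?c)"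
    using cl by (intro commuting_left_commute[OF commuting_sym]) auto
  have IH: "H i j \<otimes> ?c = asc i (Suc j) \<otimes> H i j" using step by simp
  have "H i (Suc j) \<otimes> desc i (Suc (Suc j)) = (H i j \<otimes> ?c) \<otimes> (?s \<otimes> ?c)"
    using step.hyps by simp
  also have "\<dots> = asc i (Suc j) \<otimes> (H i j \<otimes> (?s \<otimes> ?c))"
    unfolding IH using cl by (simp add: m_assoc del: descend.simps ascend.simps)
  also have "\<dots> = asc i (Suc j) \<otimes> ?s \<otimes> (H i j \<otimes> ?c)"
    unfolding c using cl by (simp add: m_assoc del: descend.simps ascend.simps)
  finally show ?case using step.hyps by simp
qed

text \<open>With one recursion for each of the two factors, the blocks in the middle meet as
  \<open>desc i (j + 1)\<close> times \<open>asc i (j + 1)\<close>. This is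
  \<open>D i (j + 1)\<close>, which commutes with \<open>H i j\<close>.\<close>

lemma H_square:
  assumes "1 \<le> i" "j \<le> Suc n"
  shows "H i j \<otimes> H i j = Z i j"
  using assms(2)
proof (induction j)
  case (Suc j)
  show ?case
  proof (cases "i \<le> j")
    case True
    let ?h = "H i j" and ?c = "desc i (Suc j)" and ?r = "asc i (Suc j)"
    have cl: "?h \<in> carrier G" "?c \<in> carrier G" "?r \<in> carrier G" "D i (Suc j) \<in> carrier G"
      using Suc assms by (auto simp del: loop.simps descend.simps ascend.simps)
    have c: "commuting (D i (Suc j)) ?h"
      using Suc.prems assms by (intro commuting_H D_inner D_closed) auto
    have "H i (Suc j) \<otimes> H i (Suc j) = ?h \<otimes> (?c \<otimes> (?h \<otimes> ?c))"
      using cl by (simp add: m_assoc del: descend.simps)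
    also have "?h \<otimes> ?c = ?r \<otimes> ?h"
      using True Suc.prems assms by (intro H_desc) auto
    also have "?h \<otimes> (?c \<otimes> (?r \<otimes> ?h)) = ?h \<otimes> (?c \<otimes> ?r \<otimes> ?h)"
      using cl by (simp add: m_assoc del: descend.simps ascend.simps)
    also have "?c \<otimes> ?r = D i (Suc j)" using Suc.prems assms by (intro desc_asc) auto
    also have "D i (Suc j) \<otimes> ?h = ?h \<otimes> D i (Suc j)" by (rule commutingD(3)[OF c])
    finally show ?thesis using cl Suc by (simp add: m_assoc[symmetric] del: loop.simps descend.simps)
  qed simp
qed simp

end

lemma ell_word_Suc:
  "1 \<le> i \<Longrightarrow> i \<le> j \<Longrightarrow> ell_word i j = ell_word i (j - 1) @ map pos (rev [i..<Suc j])"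
  by (cases j) (auto simp: ell_word_def)

lemma (in braid_system) word_eval_descend:
  assumes "1 \<le> i" "j \<le> Suc n"
  shows "word_eval G s (map pos (rev [i..<j])) = desc i j"
  using assms by (induction j) auto

text \<open>\<open>ell_word\<close> is indexed by its last letter and \<open>H\<close> by its last
  strand, hence the shift by one.\<close>

lemma (in braid_system) word_eval_ell_word:
  assumes "1 \<le> i" "j \<le> n"
  shows "word_eval G s (ell_word i j) = H i (Suc j)"
  using assms(2)
proof (induction j)
  case 0
  then show ?case using assms by (simp add: ell_word_def)
next
  case (Suc j)
  show ?case
  proof (cases "i \<le> Suc j")
    case True
    have f: "s \<in> {1..n} \<rightarrow> carrier G" by (auto intro: s_closed)
    have w: "map pos (rev [i..<Suc (Suc j)]) \<in> words_over {1..n}"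
      using assms Suc.prems by (auto simp: words_over_def)
    have w': "ell_word i j \<in> words_over {1..n}"
      using assms Suc.prems by (auto simp: words_over_def ell_word_def)
    have "word_eval G s (ell_word i (Suc j)) =
        word_eval G s (ell_word i j) \<otimes> word_eval G s (map pos (rev [i..<Suc (Suc j)]))"
      using True assms word_eval_append[OF f w' w] by (simp add: ell_word_Suc)
    also have "\<dots> = H i (Suc j) \<otimes> desc i (Suc (Suc j))"
      using Suc assms by (simp only: word_eval_descend)
    finally show ?thesis by simp
  next
    case False
    then show ?thesis by (simp add: ell_word_def)
  qed
qed

section \<open>Generated subgroups and presented groups\<close>

definition gen :: "'a set \<Rightarrow> ('a word \<times> 'a word) set \<Rightarrow> 'a \<Rightarrow> 'a word set"
  where "gen S R x = pres_class S R [pos x]"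

lemma gen_closed: "x \<in> S \<Longrightarrow> gen S R x \<in> carrier (presented_group S R)"
  by (auto simp: gen_def presented_group_def)

text \<open>This turns statements about classes of words into computations with the generators of
  the presented group.\<close>

lemma word_eval_gen:
  assumes "w \<in> words_over S"
  shows "word_eval (presented_group S R) (gen S R) w = pres_class S R w"
  using assms
proof (induction w)
  case Nil
  then show ?case by (simp add: presented_group_def)
next
  case (Cons l w)
  interpret group "presented_group S R" by (rule group_presented_group)
  obtain x b where l: "l = (x, b)" by (cases l)
  have x: "x \<in> S" and w: "w \<in> words_over S" using Cons.prems l by auto
  have "inv\<^bsub>presented_group S R\<^esub> (gen S R x) = pres_class S R [neg x]"
  proof (rule inv_equality)
    show "pres_class S R [neg x] \<otimes>\<^bsub>presented_group S R\<^esub> gen S R x = \<one>\<^bsub>presented_group S R\<^esub>"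
      using pres_class_eqI[OF pres_eq.cancel[OF x, of R False]] x
      by (simp add: gen_def presented_group_mult_class) (simp add: presented_group_def)
  qed (use x in \<open>auto simp: gen_def presented_group_def\<close>)
  then have "(if b then gen S R x else inv\<^bsub>presented_group S R\<^esub> (gen S R x)) = pres_class S R [l]"
    by (simp add: l gen_def)
  then have "word_eval (presented_group S R) (gen S R) (l # w) =
      pres_class S R [l] \<otimes>\<^bsub>presented_group S R\<^esub> pres_class S R w"
    using Cons w by (cases b) (simp_all add: l)
  then show ?case using w x by (simp add: l presented_group_mult_class)
qed

lemma presented_group_carrierE:
  assumes "X \<in> carrier (presented_group S R)"
  obtains w where "w \<in> words_over S" "X = pres_class S R w"
  using assms by (auto simp: presented_group_def)

lemma presented_group_rel:
  assumes "(u, v) \<in> R" "u \<in> words_over S" "v \<in> words_over S"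
  shows "word_eval (presented_group S R) (gen S R) u = word_eval (presented_group S R) (gen S R) v"
  using assms by (simp add: word_eval_gen pres_class_eqI pres_eq.rel)

context group
begin

lemma generate_conj:
  assumes "X \<subseteq> carrier G" "g \<in> carrier G"
    and "\<And>x. x \<in> X \<Longrightarrow> g \<otimes> (x \<otimes> inv g) \<in> generate G X"
    and "y \<in> generate G X"
  shows "g \<otimes> (y \<otimes> inv g) \<in> generate G X"
  using assms(4)
proof (induction rule: generate.induct)
  case one
  then show ?case using assms by (simp add: generate.one)
next
  case (incl h)
  then show ?case by (rule assms(3))
next
  case (inv h)
  then have h: "h \<in> carrier G" using assms(1) by auto
  have "inv (g \<otimes> (h \<otimes> inv g)) \<in> generate G X"
    using inv assms(1) by (intro generate_m_inv_closed assms(3))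
  then show ?case using h assms(2) by (simp add: inv_mult_group m_assoc)
next
  case (eng h k)
  then have hk: "h \<in> carrier G" "k \<in> carrier G" using generate_in_carrier[OF assms(1)] by auto
  have "g \<otimes> (h \<otimes> k \<otimes> inv g) = g \<otimes> (h \<otimes> inv g) \<otimes> (g \<otimes> (k \<otimes> inv g))"
    using hk assms(2) by (simp add: m_assoc)
  then show ?case using eng by (simp add: generate.eng)
qed

text \<open>Conjugation by \<open>y\<close> may map an infinite subgroup properly into itself, so
  the inverse of \<open>y\<close> has a hypothesis of its own.\<close>

lemma generate_normalize:
  assumes "X \<subseteq> carrier G" "Y \<subseteq> carrier G"
    and "\<And>x y. x \<in> X \<Longrightarrow> y \<in> Y \<Longrightarrow> y \<otimes> (x \<otimes> inv y) \<in> generate G X"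
    and "\<And>x y. x \<in> X \<Longrightarrow> y \<in> Y \<Longrightarrow> inv y \<otimes> (x \<otimes> y) \<in> generate G X"
    and "x \<in> generate G X" "y \<in> generate G Y"
  shows "y \<otimes> (x \<otimes> inv y) \<in> generate G X"
  using assms(6,5)
proof (induction arbitrary: x rule: generate.induct)
  case one
  then show ?case using generate_in_carrier[OF assms(1)] by simp
next
  case (incl h)
  then show ?case using assms(2) by (intro generate_conj[OF assms(1) _ assms(3)]) auto
next
  case (inv h)
  then have "h \<in> carrier G" using assms(2) by auto
  then have *: "inv h \<otimes> (x \<otimes> inv (inv h)) \<in> generate G X" if "x \<in> X" for x
    using inv assms(4) that by simp
  show ?case
    by (rule generate_conj[OF assms(1) _ *]) (use inv \<open>h \<in> carrier G\<close> in auto)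
next
  case (eng h k)
  then have c: "h \<in> carrier G" "k \<in> carrier G" "x \<in> carrier G"
    using generate_in_carrier[OF assms(2)] generate_in_carrier[OF assms(1)] by auto
  have "h \<otimes> k \<otimes> (x \<otimes> inv (h \<otimes> k)) = h \<otimes> (k \<otimes> (x \<otimes> inv k) \<otimes> inv h)"
    using c by (simp add: m_assoc inv_mult_group)
  with eng show ?case by simp
qed

lemma generate_word:
  assumes f: "f \<in> S \<rightarrow> carrier G" and "x \<in> generate G (f ` S)"
  shows "\<exists>w \<in> words_over S. x = word_eval G f w"
  using assms(2)
proof (induction rule: generate.induct)
  case one
  then show ?case by (intro bexI[of _ "[]"]) auto
next
  case (incl h)
  then obtain a where "a \<in> S" "h = f a" by auto
  then show ?case using f by (intro bexI[of _ "[pos a]"]) (auto simp: Pi_iff)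
next
  case (inv h)
  then obtain a where "a \<in> S" "h = f a" by auto
  then show ?case using f by (intro bexI[of _ "[neg a]"]) (auto simp: Pi_iff)
next
  case (eng h k)
  then obtain u v where "u \<in> words_over S" "h = word_eval G f u" "v \<in> words_over S" "k = word_eval G f v"
    by auto
  then show ?case by (intro bexI[of _ "u @ v"]) (auto simp: word_eval_append[OF f])
qed

lemma word_eval_generate:
  assumes "w \<in> words_over S"
  shows "word_eval G f w \<in> generate G (f ` S)"
  using assms
proof (induction w)
  case (Cons l w)
  then have "(if snd l then f (fst l) else inv (f (fst l))) \<in> generate G (f ` S)"
    by (simp add: generate.incl generate.inv)
  with Cons show ?case by (simp only: word_eval.simps generate.eng words_over_simps)
qed (simp add: generate.one)

end

section \<open>Splitting off the last strand\<close>

text \<open>The relations of the presentation as identities in a group. With the value one for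
  \<open>j \<le> i\<close>, the commutation rules extend to empty intervals, and \<open>d n\<close>
  becomes \<open>z n (n + 1)\<close>.\<close>

locale pure_braid_system = group G for G (structure) +
  fixes z :: "nat \<Rightarrow> nat \<Rightarrow> 'a" and n :: nat
  assumes z_closed': "1 \<le> i \<Longrightarrow> i < j \<Longrightarrow> j \<le> Suc n \<Longrightarrow> z i j \<in> carrier G"
    and z_triv [simp]: "j \<le> i \<Longrightarrow> z i j = \<one>"
    and z_disjoint': "1 \<le> i \<Longrightarrow> i < j \<Longrightarrow> j < k \<Longrightarrow> k < l \<Longrightarrow> l \<le> Suc n \<Longrightarrow>
      z i j \<otimes> z k l = z k l \<otimes> z i j"
    and z_nested': "1 \<le> i \<Longrightarrow> i \<le> k \<Longrightarrow> k < l \<Longrightarrow> l \<le> j \<Longrightarrow> j \<le> Suc n \<Longrightarrow>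
      z i j \<otimes> z k l = z k l \<otimes> z i j"
    and z_interlocked: "1 \<le> i \<Longrightarrow> i < x \<Longrightarrow> x \<le> j \<Longrightarrow> j < y \<Longrightarrow> y < k \<Longrightarrow> k \<le> Suc n \<Longrightarrow>
      inv (z i y) \<otimes> (z i j \<otimes> (z x y \<otimes> (z (Suc j) k \<otimes> inv (z x k)))) =
      inv (z x k) \<otimes> (z (Suc j) k \<otimes> (z x y \<otimes> (z i j \<otimes> inv (z i y))))"
begin

lemma z_closed [simp]: "1 \<le> i \<Longrightarrow> j \<le> Suc n \<Longrightarrow> z i j \<in> carrier G"
  by (cases "i < j") (auto intro: z_closed')

lemma z_disjoint:
  assumes "1 \<le> i" "j < k" "j \<le> Suc n" "l \<le> Suc n"
  shows "commuting (z i j) (z k l)"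
  using assms z_disjoint'[of i j k l]
  by (cases "i < j"; cases "k < l") (auto simp: commuting_def)

lemma z_nested:
  assumes "1 \<le> i" "i \<le> k" "l \<le> j" "j \<le> Suc n"
  shows "commuting (z i j) (z k l)"
  using assms z_nested'[of i k l j]
  by (cases "k < l") (auto simp: commuting_def)

definition d :: "nat \<Rightarrow> 'a"
  where "d i = z i (Suc n) \<otimes> inv (z i n)"

definition N :: "'a set" where "N = generate G (d ` {1..n})"

definition lower :: "(nat \<times> nat) set" where "lower = {(p, q). 1 \<le> p \<and> p < q \<and> q \<le> n}"

lemma d_closed [simp]: "1 \<le> i \<Longrightarrow> d i \<in> carrier G"
  by (simp add: d_def)

lemma d_subset: "d ` {1..n} \<subseteq> carrier G" by auto

lemma N_subgroup: "subgroup N G"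
  unfolding N_def by (intro generate_is_subgroup d_subset)

lemma d_N: "1 \<le> i \<Longrightarrow> i \<le> n \<Longrightarrow> d i \<in> N"
  unfolding N_def by (auto intro: generate.incl)

lemma N_mult: "x \<in> N \<Longrightarrow> y \<in> N \<Longrightarrow> x \<otimes> y \<in> N"
  using N_subgroup by (rule subgroup.m_closed)

lemma N_inv: "x \<in> N \<Longrightarrow> inv x \<in> N"
  using N_subgroup by (rule subgroup.m_inv_closed)

lemma d_z_commute:
  assumes "1 \<le> i" "1 \<le> p" "q \<le> n" "i \<le> p \<or> q < i"
  shows "commuting (d i) (z p q)"
proof (cases "i \<le> p")
  case True
  with assms have "commuting (z i (Suc n)) (z p q)" "commuting (z i n) (z p q)"
    by (auto intro!: z_nested)
  then show ?thesis unfolding d_def by (intro commuting_intros)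
next
  case False
  with assms have "commuting (z i (Suc n)) (z p q)" "commuting (z i n) (z p q)"
    by (auto intro!: commuting_sym[OF z_disjoint])
  then show ?thesis unfolding d_def by (intro commuting_intros)
qed

lemma z_top_d_commute:
  assumes "1 \<le> p" "p \<le> i"
  shows "commuting (z p (Suc n)) (d i)"
  unfolding d_def using assms by (intro commuting_mult_right commuting_inv_right z_nested) auto

lemma z_d_top:
  assumes "1 \<le> p" "p \<le> n"
  shows "z p n = inv (d p) \<otimes> z p (Suc n)"
  using assms by (simp add: d_def inv_mult_group m_assoc)

text \<open>This is relation (2) with \<open>y = n\<close> and \<open>k = n + 1\<close> in terms of
  \<open>d\<close>. Cancelling \<open>?c = z (q + 1) n\<close> leaves the equality of
  \<open>?P\<close> times \<open>?X\<close> with \<open>?Y\<close> times \<open>?P\<close>; then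
  \<open>z p n\<close> is replaced by means of \<open>d p\<close> and \<open>z p (n + 1)\<close>,
  the latter commuting with \<open>?Y\<close>.\<close>

lemma d_relation:
  assumes "1 \<le> p" "p < i" "i \<le> q" "q < n"
  shows "z p q \<otimes> (inv (d i) \<otimes> d (Suc q)) =
    inv (d p) \<otimes> (d (Suc q) \<otimes> (inv (d i) \<otimes> (d p \<otimes> z p q)))"
proof -
  let ?k = "Suc n" and ?c = "z (Suc q) n" and ?P = "inv (z p n) \<otimes> z p q"
  let ?X = "inv (d i) \<otimes> d (Suc q)" and ?Y = "d (Suc q) \<otimes> inv (d i)"
  have cl: "z p n \<in> carrier G" "z p q \<in> carrier G" "z i n \<in> carrier G" "z (Suc q) ?k \<in> carrier G"
    "z i ?k \<in> carrier G" "?c \<in> carrier G" "d p \<in> carrier G" "d i \<in> carrier G" "d (Suc q) \<in> carrier G"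
    "z p ?k \<in> carrier G"
    using assms by auto
  have k1: "commuting (z i ?k) (z (Suc q) ?k)" "commuting (z i ?k) (z i n)" "commuting (z p n) (z p q)"
    using assms by (auto intro!: z_nested)
  have di: "inv (d i) = z i n \<otimes> inv (z i ?k)"
    using cl assms by (simp add: d_def inv_mult_group)
  have di': "inv (d i) = inv (z i ?k) \<otimes> z i n"
    unfolding di using commutingD(3)[OF commuting_inv[OF k1(2)]] by simp
  have e: "z (Suc q) ?k = d (Suc q) \<otimes> ?c" using cl by (simp add: d_def m_assoc)
  have P: "z p q \<otimes> inv (z p n) = ?P"
    using commutingD(3)[OF commuting_inv[OF k1(3)]] by simp
  have "commuting (z p n) ?c" using assms by (intro z_nested) auto
  moreover have "commuting (z p q) ?c" using assms by (intro z_disjoint) auto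
  moreover have "commuting (d i) ?c" using assms by (intro d_z_commute) auto
  ultimately have c: "commuting (inv (d i) \<otimes> ?P) ?c" by (intro commuting_intros)
  have "?P \<otimes> ?X \<otimes> ?c = ?P \<otimes> (z i n \<otimes> (inv (z i ?k) \<otimes> z (Suc q) ?k))"
    unfolding di e using cl by (simp add: m_assoc)
  also have "\<dots> = inv (z p n) \<otimes> (z p q \<otimes> (z i n \<otimes> (z (Suc q) ?k \<otimes> inv (z i ?k))))"
    using commutingD(3)[OF commuting_inv[OF k1(1)]] cl by (simp add: m_assoc)
  also have "\<dots> = inv (z i ?k) \<otimes> (z (Suc q) ?k \<otimes> (z i n \<otimes> (z p q \<otimes> inv (z p n))))"
    using assms by (intro z_interlocked) auto
  also have "\<dots> = z (Suc q) ?k \<otimes> (inv (z i ?k) \<otimes> (z i n \<otimes> ?P))"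
    unfolding P using cl commuting_inv[OF k1(1)] by (intro commuting_left_commute) auto
  also have "\<dots> = d (Suc q) \<otimes> (?c \<otimes> (inv (d i) \<otimes> ?P))"
    unfolding di' e using cl by (simp add: m_assoc)
  also have "\<dots> = ?Y \<otimes> ?P \<otimes> ?c"
    using cl commutingD(3)[OF c] by (simp add: m_assoc)
  finally have PX: "?P \<otimes> ?X = ?Y \<otimes> ?P" using cl by simp
  have "commuting (z p ?k) (d i)" "commuting (z p ?k) (d (Suc q))"
    using assms by (auto intro!: z_top_d_commute)
  then have t: "commuting (z p ?k) ?Y" by (intro commuting_intros)
  have zp: "z p n = inv (d p) \<otimes> z p ?k" using assms by (intro z_d_top) auto
  have "z p q \<otimes> ?X = z p n \<otimes> (?P \<otimes> ?X)" using cl by (simp add: m_assoc)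
  also have "\<dots> = z p n \<otimes> (?Y \<otimes> ?P)" by (simp only: PX)
  also have "\<dots> = inv (d p) \<otimes> (z p ?k \<otimes> ?Y \<otimes> (inv (z p ?k) \<otimes> (d p \<otimes> z p q)))"
    unfolding zp using cl by (simp add: m_assoc inv_mult_group)
  also have "\<dots> = inv (d p) \<otimes> (?Y \<otimes> (d p \<otimes> z p q))"
    unfolding commutingD(3)[OF t] using cl by (simp add: m_assoc)
  finally show ?thesis using cl by (simp add: m_assoc)
qed

lemma inv_mem_N: "x \<in> carrier G \<Longrightarrow> inv x \<in> N \<Longrightarrow> x \<in> N"
  using N_inv[of "inv x"] by simp

lemma conj_d_N:
  assumes "1 \<le> p" "p < q" "q \<le> n" "1 \<le> i" "i \<le> n"
  shows "z p q \<otimes> (d i \<otimes> inv (z p q)) \<in> N" (is ?A) and "inv (z p q) \<otimes> (d i \<otimes> z p q) \<in> N" (is ?B)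
proof -
  let ?z = "z p q"
  have cl: "?z \<in> carrier G" "d i \<in> carrier G" "d p \<in> carrier G" using assms by auto
  consider "i \<le> p \<or> q < i" | "p < i" "i \<le> q" "q = n" | "p < i" "i \<le> q" "q < n"
    using assms by linarith
  then have "?A \<and> ?B"
  proof cases
    case 1
    then have c: "commuting (d i) ?z" using assms by (intro d_z_commute) auto
    have "?z \<otimes> (d i \<otimes> inv ?z) = d i" "inv ?z \<otimes> (d i \<otimes> ?z) = d i"
      using cl commutingD(3)[OF c] commuting_left_commute[OF commuting_sym[OF c], of "inv ?z"]
      by simp_all
    with assms show ?thesis by (simp add: d_N)
  next
    case 2
    \<comment> \<open>Since \<open>?z\<close> is the inverse of \<open>d p\<close> times
      \<open>?t\<close>, and \<open>?t\<close> commutes with \<open>d i\<close>, conjugating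
      \<open>d i\<close> by \<open>?z\<close> amounts to conjugating it by the inverse of
      \<open>d p\<close>.\<close>
    let ?t = "z p (Suc n)"
    have tc: "?t \<in> carrier G" using assms by auto
    have z: "?z = inv (d p) \<otimes> ?t" using assms 2 by (simp add: z_d_top)
    have t: "commuting ?t (d i)" "commuting ?t (d p)" using assms 2 by (auto intro!: z_top_d_commute)
    then have "commuting ?t (d p \<otimes> (d i \<otimes> inv (d p)))" by (intro commuting_conj)
    note t' = commutingD(3)[OF this]
    have "?z \<otimes> (d i \<otimes> inv ?z) = inv (d p) \<otimes> (?t \<otimes> d i \<otimes> (inv ?t \<otimes> d p))"
      unfolding z using cl tc by (simp add: m_assoc inv_mult_group)
    also have "\<dots> = inv (d p) \<otimes> (d i \<otimes> d p)"
      unfolding commutingD(3)[OF t(1)] using cl tc by (simp add: m_assoc)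
    finally have 1: "?z \<otimes> (d i \<otimes> inv ?z) = inv (d p) \<otimes> (d i \<otimes> d p)" .
    have "inv ?z \<otimes> (d i \<otimes> ?z) = inv ?t \<otimes> (d p \<otimes> (d i \<otimes> inv (d p)) \<otimes> ?t)"
      unfolding z using cl tc by (simp add: m_assoc inv_mult_group)
    also have "\<dots> = d p \<otimes> (d i \<otimes> inv (d p))"
      unfolding t'[symmetric] using cl tc by simp
    finally have 2: "inv ?z \<otimes> (d i \<otimes> ?z) = d p \<otimes> (d i \<otimes> inv (d p))" .
    show ?thesis unfolding 1 2 using assms by (intro conjI N_mult N_inv d_N) auto
  next
    case 3
    let ?e = "d (Suc q)"
    have e: "?e \<in> carrier G" by simp
    have c: "commuting ?e ?z" "commuting (d p) ?z"
      using assms 3 by (auto intro!: d_z_commute)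
    have N: "?e \<in> N" "d i \<in> N" "d p \<in> N" using assms 3 by (auto intro: d_N)
    \<comment> \<open>The relation conjugates the inverse of \<open>d i\<close> times
      \<open>?e\<close>, and \<open>?e\<close> commutes with \<open>?z\<close>. It thus yields the
      conjugates of the inverse of \<open>d i\<close>, whence the use of
      \<open>inv_mem_N\<close>.\<close>
    note r = d_relation[OF assms(1) 3]
    have "inv (?z \<otimes> (d i \<otimes> inv ?z)) = ?z \<otimes> (inv (d i) \<otimes> ?e) \<otimes> (inv ?e \<otimes> inv ?z)"
      using cl e by (simp add: m_assoc inv_mult_group)
    also have "\<dots> = inv (d p) \<otimes> (?e \<otimes> (inv (d i) \<otimes> (d p \<otimes> (?z \<otimes> (inv ?e \<otimes> inv ?z)))))"
      unfolding r using cl e by (simp add: m_assoc)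
    also have "?z \<otimes> (inv ?e \<otimes> inv ?z) = inv ?e"
      using cl e commuting_left_commute[OF commuting_sym[OF commuting_inv[OF c(1)]]] by simp
    also have "inv (d p) \<otimes> (?e \<otimes> (inv (d i) \<otimes> (d p \<otimes> inv ?e))) \<in> N"
      using N by (intro N_mult N_inv)
    finally have A: ?A by (rule inv_mem_N[rotated]) (use cl in auto)
    have "inv (inv ?z \<otimes> (d i \<otimes> ?z)) = inv ?z \<otimes> (inv (d i) \<otimes> (d p \<otimes> ?z)) \<otimes> inv (d p)"
      using cl commutingD(3)[OF c(2)] commuting_left_commute[OF c(2), of "inv (d p)"]
      by (simp add: m_assoc inv_mult_group)
    also have "inv (d i) \<otimes> (d p \<otimes> ?z) = inv ?e \<otimes> (d p \<otimes> (?z \<otimes> (inv (d i) \<otimes> ?e)))"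
      unfolding r using cl e by simp
    also have "inv ?z \<otimes> (inv ?e \<otimes> (d p \<otimes> (?z \<otimes> (inv (d i) \<otimes> ?e)))) =
        inv ?e \<otimes> (d p \<otimes> (inv (d i) \<otimes> ?e))"
    proof -
      have "commuting ?z (inv ?e \<otimes> d p)"
        using c by (intro commuting_intros) (auto intro: commuting_sym)
      then have "commuting (inv ?z) (inv ?e \<otimes> d p)" by (rule commuting_inv)
      from commuting_left_commute[OF this, of "?z \<otimes> (inv (d i) \<otimes> ?e)"] show ?thesis
        using cl e by (simp add: m_assoc)
    qed
    also have "inv ?e \<otimes> (d p \<otimes> (inv (d i) \<otimes> ?e)) \<otimes> inv (d p) \<in> N"
      using N by (intro N_mult N_inv)
    finally have ?B by (rule inv_mem_N[rotated]) (use cl in auto)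
    with A show ?thesis by simp
  qed
  then show ?A ?B by auto
qed

lemma lower_closed: "(\<lambda>(p, q). z p q) ` lower \<subseteq> carrier G"
  by (auto simp: lower_def)

lemma N_normalized:
  assumes "h \<in> generate G ((\<lambda>(p, q). z p q) ` lower)" "x \<in> N"
  shows "h \<otimes> (x \<otimes> inv h) \<in> N"
  unfolding N_def
  by (rule generate_normalize[OF d_subset lower_closed _ _ _ assms(1)])
    (use assms(2) conj_d_N in \<open>auto simp: lower_def N_def\<close>)

lemma N_lower_decomp:
  assumes "g \<in> generate G ((\<lambda>(p, q). z p q) ` pure_gens n)"
  shows "\<exists>x \<in> N. \<exists>h \<in> generate G ((\<lambda>(p, q). z p q) ` lower). g = x \<otimes> h"
proof -
  let ?H = "generate G ((\<lambda>(p, q). z p q) ` lower)"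
  have Hc: "h \<in> carrier G" if "h \<in> ?H" for h using generate_in_carrier[OF lower_closed that] .
  have Nc: "x \<in> carrier G" if "x \<in> N" for x using subgroup.mem_carrier[OF N_subgroup that] .
  have N1: "\<one> \<in> N" using N_subgroup by (rule subgroup.one_closed)
  have H1: "\<one> \<in> ?H" by (rule generate.one)
  \<comment> \<open>The last strand is split off by writing \<open>z p (n + 1)\<close> as
    \<open>d p\<close> times \<open>z p n\<close>. These factors commute, so the inverse splits in
    the same order.\<close>
  have gen: "\<exists>x \<in> N. \<exists>h \<in> ?H. z p q = x \<otimes> h \<and> inv (z p q) = inv x \<otimes> inv h" if "(p, q) \<in> pure_gens n" for p q
  proof (cases "q \<le> n")
    case True
    then have "z p q \<in> ?H" using that by (intro generate.incl) (auto simp: lower_def pure_gens_def)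
    with N1 show ?thesis using Hc by (intro bexI[of _ "\<one>"] bexI[of _ "z p q"]) auto
  next
    case False
    then have q: "q = Suc n" "1 \<le> p" "p \<le> n" using that by (auto simp: pure_gens_def)
    have h: "z p n \<in> ?H"
    proof (cases "p = n")
      case False
      then show ?thesis using q by (intro generate.incl) (auto simp: lower_def)
    qed (simp add: H1)
    have eq: "z p q = d p \<otimes> z p n" using q by (simp add: d_def m_assoc)
    have "commuting (inv (z p n)) (inv (d p))"
      using q by (intro commuting_inv commuting_inv_right commuting_sym[OF d_z_commute]) auto
    from commutingD(3)[OF this] have "inv (z p q) = inv (d p) \<otimes> inv (z p n)"
      unfolding eq using q by (simp add: inv_mult_group)
    with h eq q show ?thesis using d_N by (intro bexI[of _ "d p"] bexI[of _ "z p n"]) auto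
  qed
  show ?thesis
    using assms
  proof (induction rule: generate.induct)
    case one
    then show ?case using N1 H1 by (intro bexI[of _ "\<one>"]) auto
  next
    case (incl g)
    then obtain p q where "(p, q) \<in> pure_gens n" "g = z p q" by auto
    then show ?case using gen by blast
  next
    case (inv g)
    then obtain p q where "(p, q) \<in> pure_gens n" "g = z p q" by auto
    then obtain x h where "x \<in> N" "h \<in> ?H" "inv g = inv x \<otimes> inv h" using gen by blast
    then show ?case using N_inv generate_m_inv_closed[OF lower_closed] by blast
  next
    case (eng g g')
    then obtain x h x' h' where *: "x \<in> N" "h \<in> ?H" "g = x \<otimes> h" "x' \<in> N" "h' \<in> ?H" "g' = x' \<otimes> h'"
      by blast
    have "g \<otimes> g' = (x \<otimes> (h \<otimes> (x' \<otimes> inv h))) \<otimes> (h \<otimes> h')"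
      using * Nc Hc by (simp add: m_assoc)
    moreover have "x \<otimes> (h \<otimes> (x' \<otimes> inv h)) \<in> N" using * by (intro N_mult N_normalized)
    moreover have "h \<otimes> h' \<in> ?H" using * by (intro generate.eng)
    ultimately show ?case by blast
  qed
qed

end

section \<open>Homomorphisms and the pure braid relations\<close>

lemma (in group) word_eval_fun_cong:
  assumes "\<And>a. a \<in> S \<Longrightarrow> f a = g a" "w \<in> words_over S"
  shows "word_eval G f w = word_eval G g w"
  using assms(2) by (induction w) (auto simp: assms(1))

lemma pres_eq_mono:
  assumes "S \<subseteq> S'" "R \<subseteq> R'" "pres_eq S R u v"
  shows "pres_eq S' R' u v"
proof -
  have words: "words_over S \<subseteq> words_over S'"
    using assms(1) unfolding words_over_def by (intro lists_mono Sigma_mono) auto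
  show ?thesis
    using assms(3)
  proof (induction rule: pres_eq.induct)
    case (trans u v w)
    show ?case by (rule pres_eq.trans[OF trans.IH])
  qed (use assms(1,2) words in \<open>auto intro: pres_eq.refl pres_eq.sym pres_eq.cong pres_eq.cancel pres_eq.rel\<close>)
qed

lemma hom_word_eval:
  assumes "group G" "group K" "h \<in> hom G K" "f \<in> S \<rightarrow> carrier G" "w \<in> words_over S"
  shows "h (word_eval G f w) = word_eval K (h \<circ> f) w"
proof -
  interpret h: group_hom G K h using assms by (simp add: group_hom_def group_hom_axioms_def)
  show ?thesis
    using assms(5)
  proof (induction w)
    case (Cons l w)
    then have "f (fst l) \<in> carrier G" "word_eval G f w \<in> carrier G"
      using assms(4) h.G.word_eval_closed[OF assms(4)] by auto
    with Cons show ?case by simp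
  qed simp
qed

lemma hom_loop:
  assumes "group G" "group K" "h \<in> hom G K" "\<And>m. i \<le> m \<Longrightarrow> m < j \<Longrightarrow> s m \<in> carrier G"
  shows "loop G s i j \<in> carrier G \<and> h (loop G s i j) = loop K (h \<circ> s) i j"
proof -
  interpret h: group_hom G K h using assms by (simp add: group_hom_def group_hom_axioms_def)
  show ?thesis using assms(4) by (induction j) auto
qed

lemma hom_full_twist:
  assumes "group G" "group K" "h \<in> hom G K" "\<And>m. i \<le> m \<Longrightarrow> m < j \<Longrightarrow> s m \<in> carrier G"
  shows "full_twist G s i j \<in> carrier G \<and> h (full_twist G s i j) = full_twist K (h \<circ> s) i j"
proof -
  interpret h: group_hom G K h using assms by (simp add: group_hom_def group_hom_axioms_def)
  show ?thesis
    using assms(4)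
  proof (induction j)
    case (Suc j)
    then show ?case using hom_loop[OF assms(1-3), of i "Suc j" s] by (simp add: o_def del: loop.simps)
  qed simp
qed

context group
begin

lemma loop_subgroup:
  assumes "subgroup H G" "\<And>m. i \<le> m \<Longrightarrow> m < j \<Longrightarrow> s m \<in> H"
  shows "loop G s i j \<in> H"
  using assms(2)
  by (induction j) (auto intro!: subgroup.m_closed[OF assms(1)] subgroup.one_closed[OF assms(1)])

lemma full_twist_subgroup:
  assumes "subgroup H G" "\<And>m. i \<le> m \<Longrightarrow> m < j \<Longrightarrow> s m \<in> H"
  shows "full_twist G s i j \<in> H"
  using assms(2)
proof (induction j)
  case (Suc j)
  then have "loop G s i (Suc j) \<in> H" by (intro loop_subgroup[OF assms(1)]) auto
  then show ?case using Suc by (simp add: subgroup.m_closed[OF assms(1)] del: loop.simps)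
qed (simp add: subgroup.one_closed[OF assms(1)])

lemma word_eval_subgroup:
  assumes "subgroup H G" "\<And>a. a \<in> S \<Longrightarrow> f a \<in> H" "w \<in> words_over S"
  shows "word_eval G f w \<in> H"
  using assms(3)
  by (induction w)
    (auto simp: assms(2) subgroup.one_closed[OF assms(1)] intro!: subgroup.m_closed[OF assms(1)]
      subgroup.m_inv_closed[OF assms(1)])

end

context braid_system
begin

lemma Z_assignment: "(\<lambda>(i, j). Z i j) \<in> pure_gens n \<rightarrow> carrier G"
  by (auto simp: pure_gens_def)

lemma pure_rels_hold:
  assumes "(u, v) \<in> pure_rels n"
  shows "word_eval G (\<lambda>(i, j). Z i j) u = word_eval G (\<lambda>(i, j). Z i j) v"
proof -
  consider i j k l where "u = [pos (i, j), pos (k, l)]" "v = [pos (k, l), pos (i, j)]"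
      "(i, j) \<in> pure_gens n" "(k, l) \<in> pure_gens n"
      "j + 1 \<le> k \<or> (k \<le> i \<and> i \<le> j \<and> j \<le> l) \<or> (i \<le> k \<and> k \<le> l \<and> l \<le> j)"
    | i x j y k where "u = [neg (i, y), pos (i, j), pos (x, y), pos (j + 1, k), neg (x, k)]"
      "v = [neg (x, k), pos (j + 1, k), pos (x, y), pos (i, j), neg (i, y)]"
      "1 \<le> i \<and> i < x \<and> x \<le> j \<and> j < y \<and> y < k \<and> k \<le> n + 1"
    using assms unfolding pure_rels_def by blast
  then show ?thesis
  proof cases
    case (1 i j k l)
    have "commuting (Z i j) (Z k l)"
      using 1(3-5) Z_disjoint[of i j k l] Z_nested[of i k l j] commuting_sym[OF Z_nested[of k i j l]]
      by (auto simp: pure_gens_def)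
    then show ?thesis using 1(1,2) by (simp add: commuting_def)
  next
    case (2 i x j y k)
    then show ?thesis using Z_interlocked[of i x j y k] by simp
  qed
qed

text \<open>For \<open>j = n\<close> this identifies the image of \<open>d i\<close> in the braid
  system; in general it recovers the loops from the full twists.\<close>

lemma Z_top:
  assumes "1 \<le> i" "j \<le> n"
  shows "Z i (Suc j) \<otimes> inv (Z i j) = D i (Suc j)"
proof -
  have cl: "Z i j \<in> carrier G" "D i (Suc j) \<in> carrier G" using assms by (auto simp del: loop.simps)
  have "commuting (D i (Suc j)) (Z i j)" using assms by (intro D_Z_nested) auto
  from commuting_left_commute[OF commuting_sym[OF this], of "inv (Z i j)"] show ?thesis
    using cl by (simp add: m_assoc del: loop.simps)
qed

end

section \<open>The Hurwitz action on sequences in a rack\<close>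

text \<open>The flag \<open>False\<close> marks the elements that act trivially. Outside the carrier the operation is trivial, which
  makes it a rack operation on the whole type.\<close>

definition rack_op :: "('a, 'm) monoid_scheme \<Rightarrow> 'a \<times> bool \<Rightarrow> 'a \<times> bool \<Rightarrow> 'a \<times> bool"
  where "rack_op K a b =
    (if snd a \<and> fst a \<in> carrier K \<and> fst b \<in> carrier K
     then (fst a \<otimes>\<^bsub>K\<^esub> fst b \<otimes>\<^bsub>K\<^esub> (if snd b then inv\<^bsub>K\<^esub> (fst a) else \<one>\<^bsub>K\<^esub>), snd b)
     else b)"

text \<open>The inverse of an element outside the carrier is unspecified and might lie in the
  carrier; the condition in the flag makes such an element act trivially.\<close>

definition rack_inv :: "('a, 'm) monoid_scheme \<Rightarrow> 'a \<times> bool \<Rightarrow> 'a \<times> bool \<Rightarrow> 'a \<times> bool"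
  where "rack_inv K a b = rack_op K (inv\<^bsub>K\<^esub> (fst a), snd a \<and> fst a \<in> carrier K) b"

definition hurwitz :: "('a, 'm) monoid_scheme \<Rightarrow> nat \<Rightarrow> (nat \<Rightarrow> 'a \<times> bool) \<Rightarrow> (nat \<Rightarrow> 'a \<times> bool)"
  where "hurwitz K i f = f(i := rack_op K (f i) (f (Suc i)), Suc i := f i)"

text \<open>An entry \<open>c\<close> at position \<open>j\<close> turns into this when it moves
  left past the entries at \<open>j - 1, ..., i\<close>, each of which acts on it in turn.\<close>

primrec rack_pass :: "('a, 'm) monoid_scheme \<Rightarrow> (nat \<Rightarrow> 'a \<times> bool) \<Rightarrow> nat \<Rightarrow> nat \<Rightarrow> 'a \<times> bool \<Rightarrow> 'a \<times> bool"
  where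
    "rack_pass K f i 0 c = c"
  | "rack_pass K f i (Suc j) c = (if i \<le> j then rack_pass K f i j (rack_op K (f j) c) else c)"

lemma rack_pass_cong: "(\<And>m. m < j \<Longrightarrow> f m = g m) \<Longrightarrow> rack_pass K f i j c = rack_pass K g i j c"
  by (induction j arbitrary: c) auto

lemma rack_op_marked [simp]: "rack_op K (u, False) b = b"
  by (simp add: rack_op_def)

context group
begin

lemma rack_self_distrib: "rack_op G a (rack_op G b c) = rack_op G (rack_op G a b) (rack_op G a c)"
  by (auto simp: rack_op_def m_assoc inv_mult_group)

lemma rack_op_inv: "rack_op G a (rack_inv G a b) = b" "rack_inv G a (rack_op G a b) = b"
  by (auto simp: rack_op_def rack_inv_def m_assoc intro!: prod_eqI)

lemma hurwitz_bij: "bij (hurwitz G i)"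
proof -
  let ?g = "\<lambda>f. f(i := f (Suc i), Suc i := rack_inv G (f (Suc i)) (f i))"
  have "?g \<circ> hurwitz G i = id" "hurwitz G i \<circ> ?g = id"
    by (auto simp: hurwitz_def rack_op_inv fun_eq_iff)
  then show ?thesis by (rule o_bij)
qed

text \<open>The multiplier is the product of the unmarked entries that lie in the carrier; all other
  entries act trivially.\<close>

lemma rack_pass_marked:
  "\<exists>k \<in> carrier G. \<forall>u \<in> carrier G. rack_pass G f i j (u, False) = (k \<otimes> u, False)"
proof (induction j)
  case 0
  then show ?case by (intro bexI[of _ \<one>]) auto
next
  case (Suc j)
  then obtain k where k: "k \<in> carrier G" "\<forall>u \<in> carrier G. rack_pass G f i j (u, False) = (k \<otimes> u, False)"
    by blast
  show ?case
  proof (cases "i \<le> j \<and> snd (f j) \<and> fst (f j) \<in> carrier G")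
    case True
    with k show ?thesis by (intro bexI[of _ "k \<otimes> fst (f j)"]) (auto simp: rack_op_def m_assoc)
  next
    case False
    then have "rack_pass G f i (Suc j) c = (if i \<le> j then rack_pass G f i j c else c)" for c
      by (auto simp: rack_op_def)
    with k show ?thesis
      by (cases "i \<le> j") (auto intro: bexI[of _ k] bexI[of _ \<one>])
  qed
qed

end

abbreviation Sym :: "('a \<Rightarrow> 'a) monoid" where "Sym \<equiv> BijGroup UNIV"

lemma Sym_carrier [simp]: "f \<in> carrier Sym \<longleftrightarrow> bij f"
  by (simp add: BijGroup_def Bij_def)

lemma Sym_mult: "bij f \<Longrightarrow> bij g \<Longrightarrow> f \<otimes>\<^bsub>Sym\<^esub> g = f \<circ> g"
  by (simp add: BijGroup_def Bij_def compose_def fun_eq_iff)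

lemma Sym_one: "\<one>\<^bsub>Sym\<^esub> = id"
  by (simp add: BijGroup_def fun_eq_iff)

lemma Sym_inv:
  assumes "bij f"
  shows "(inv\<^bsub>Sym\<^esub> f) (f x) = x" "f ((inv\<^bsub>Sym\<^esub> f) x) = x"
proof -
  interpret group Sym by (rule group_BijGroup)
  have f: "f \<in> carrier Sym" using assms by simp
  then have "inv\<^bsub>Sym\<^esub> f \<in> carrier Sym" by (rule inv_closed)
  then have "bij (inv\<^bsub>Sym\<^esub> f)" by simp
  with l_inv[OF f] r_inv[OF f] assms show "(inv\<^bsub>Sym\<^esub> f) (f x) = x" "f ((inv\<^bsub>Sym\<^esub> f) x) = x"
    by (simp_all add: Sym_mult Sym_one fun_eq_iff)
qed

text \<open>Distant moves touch disjoint positions. For neighbouring moves the braid relation is the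
  self-distributivity of the rack.\<close>

lemma (in group) hurwitz_braid_system: "braid_system Sym (hurwitz G) n"
proof -
  interpret S: group Sym by (rule group_BijGroup)
  note b = hurwitz_bij bij_comp[OF hurwitz_bij hurwitz_bij]
  show ?thesis
  proof
    show "hurwitz G i \<otimes>\<^bsub>Sym\<^esub> hurwitz G j = hurwitz G j \<otimes>\<^bsub>Sym\<^esub> hurwitz G i" if "i + 2 \<le> j" for i j
      using that by (auto simp: Sym_mult b hurwitz_def fun_eq_iff)
    show "hurwitz G i \<otimes>\<^bsub>Sym\<^esub> (hurwitz G (Suc i) \<otimes>\<^bsub>Sym\<^esub> hurwitz G i) =
        hurwitz G (Suc i) \<otimes>\<^bsub>Sym\<^esub> (hurwitz G i \<otimes>\<^bsub>Sym\<^esub> hurwitz G (Suc i))" for i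
      by (auto simp: Sym_mult b hurwitz_def fun_eq_iff rack_self_distrib[symmetric])
  qed (simp add: hurwitz_bij)
qed

text \<open>The last entry moves to position \<open>i\<close> and turns into \<open>V\<close>; on
  its way back, \<open>V\<close> acts on each entry that it passes.\<close>

lemma (in group) hurwitz_loop:
  assumes "1 \<le> i" "i \<le> j"
  shows "loop Sym (hurwitz G) i j f =
    (let V = rack_pass G f i j (f j) in
     (\<lambda>m. if i \<le> m \<and> m < j then rack_op G V (f m) else if m = j then V else f m))"
  using assms(2)
proof (induction j arbitrary: f rule: dec_induct)
  case base
  have "rack_pass G f i i c = c" for c by (cases i) auto
  then show ?case using assms by (cases i) (auto simp: Sym_one Let_def fun_eq_iff)
next
  case (step j)
  interpret S: braid_system Sym "hurwitz G" j by (rule hurwitz_braid_system)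
  let ?g = "hurwitz G j f"
  have "loop Sym (hurwitz G) i j \<in> carrier Sym" using assms by (intro S.D_closed) auto
  then have b: "bij (loop Sym (hurwitz G) i j)" by simp
  have eq: "loop Sym (hurwitz G) i (Suc j) f = hurwitz G j (loop Sym (hurwitz G) i j ?g)"
    using step b bij_comp[OF hurwitz_bij b] by (simp add: Sym_mult hurwitz_bij bij_comp)
  have V: "rack_pass G ?g i j (?g j) = rack_pass G f i (Suc j) (f (Suc j))"
    using step rack_pass_cong[of j ?g f] by (simp add: hurwitz_def)
  show ?case
    unfolding eq step.IH V Let_def using step by (auto simp: hurwitz_def fun_eq_iff)
qed


section \<open>Multiplication of a marked entry\<close>

definition marked_action :: "('a, 'm) monoid_scheme \<Rightarrow> (nat \<Rightarrow> 'a \<times> bool) \<Rightarrow> nat \<Rightarrow>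
    ((nat \<Rightarrow> 'a \<times> bool) \<Rightarrow> nat \<Rightarrow> 'a \<times> bool) \<Rightarrow> 'a \<Rightarrow> bool"
  where "marked_action K f j b k \<longleftrightarrow> b \<in> carrier Sym \<and> k \<in> carrier K \<and>
    (\<forall>u \<in> carrier K. b (f(j := (u, False))) = f(j := (k \<otimes>\<^bsub>K\<^esub> u, False)))"

context group
begin

lemma marked_action_one: "marked_action G f j \<one>\<^bsub>Sym\<^esub> \<one>"
  by (simp add: marked_action_def Sym_one)

lemma marked_action_mult:
  assumes "marked_action G f j b k" "marked_action G f j c l"
  shows "marked_action G f j (b \<otimes>\<^bsub>Sym\<^esub> c) (k \<otimes> l)"
  using assms by (simp add: marked_action_def Sym_mult bij_comp m_assoc)

lemma marked_action_inv:
  assumes "marked_action G f j b k"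
  shows "marked_action G f j (inv\<^bsub>Sym\<^esub> b) (inv k)"
proof -
  interpret S: group Sym by (rule group_BijGroup)
  have b: "b \<in> carrier Sym" and k: "k \<in> carrier G"
    and act: "\<And>u. u \<in> carrier G \<Longrightarrow> b (f(j := (u, False))) = f(j := (k \<otimes> u, False))"
    using assms by (auto simp: marked_action_def)
  have "(inv\<^bsub>Sym\<^esub> b) (f(j := (u, False))) = f(j := (inv k \<otimes> u, False))" if "u \<in> carrier G" for u
  proof -
    have "b (f(j := (inv k \<otimes> u, False))) = f(j := (u, False))"
      using act[of "inv k \<otimes> u"] k that by simp
    then show ?thesis using Sym_inv(1)[of b] b by (metis Sym_carrier)
  qed
  then show ?thesis using S.inv_closed[OF b] k by (simp add: marked_action_def)
qed

text \<open>In \<open>hurwitz_loop\<close> the entry \<open>V\<close> is now marked and acts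
  trivially, so only the entry at \<open>j\<close> changes.\<close>

lemma marked_action_loop:
  assumes "1 \<le> i" "i \<le> j" "k \<in> carrier G"
    and "\<And>u. u \<in> carrier G \<Longrightarrow> rack_pass G f i j (u, False) = (k \<otimes> u, False)"
  shows "marked_action G f j (loop Sym (hurwitz G) i j) k"
proof -
  interpret S: braid_system Sym "hurwitz G" j by (rule hurwitz_braid_system)
  have "rack_pass G (f(j := c)) i j c' = rack_pass G f i j c'" for c c'
    by (rule rack_pass_cong) simp
  then have "loop Sym (hurwitz G) i j (f(j := (u, False))) = f(j := (k \<otimes> u, False))"
    if "u \<in> carrier G" for u
    using that assms by (auto simp: hurwitz_loop Let_def fun_eq_iff)
  moreover have "loop Sym (hurwitz G) i j \<in> carrier Sym" using assms by (intro S.D_closed) auto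
  ultimately show ?thesis using assms by (auto simp: marked_action_def)
qed

end

text \<open>These bijections neither read nor change the entry at \<open>j\<close>. The full twists
  on the first \<open>n\<close> strands have this property for \<open>j = n + 1\<close>.\<close>

definition ignoring :: "nat \<Rightarrow> ((nat \<Rightarrow> 'b) \<Rightarrow> nat \<Rightarrow> 'b) set"
  where "ignoring j = {b. bij b \<and> (\<forall>f c. b (f(j := c)) = (b f)(j := c))}"

lemma ignoring_subgroup: "subgroup (ignoring j) Sym"
proof -
  interpret S: group Sym by (rule group_BijGroup)
  show ?thesis
  proof (rule S.subgroupI)
    show "ignoring j \<subseteq> carrier Sym" by (auto simp: ignoring_def)
    have "id \<in> ignoring j" by (simp add: ignoring_def)
    then show "ignoring j \<noteq> {}" by blast
  next
    fix a b :: "(nat \<Rightarrow> 'a) \<Rightarrow> nat \<Rightarrow> 'a"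
    assume ab: "a \<in> ignoring j" "b \<in> ignoring j"
    then show "a \<otimes>\<^bsub>Sym\<^esub> b \<in> ignoring j" by (simp add: ignoring_def Sym_mult bij_comp)
    have a: "bij a" "\<And>f c. a (f(j := c)) = (a f)(j := c)" using ab by (auto simp: ignoring_def)
    have "(inv\<^bsub>Sym\<^esub> a) (f(j := c)) = ((inv\<^bsub>Sym\<^esub> a) f)(j := c)" for f c
      using Sym_inv[OF a(1)] a(2) by metis
    moreover have "inv\<^bsub>Sym\<^esub> a \<in> carrier Sym" using a by (intro S.inv_closed) simp
    ultimately show "inv\<^bsub>Sym\<^esub> a \<in> ignoring j" by (simp add: ignoring_def)
  qed
qed

lemma (in group) hurwitz_ignoring: "Suc i < j \<Longrightarrow> hurwitz G i \<in> ignoring j"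
  by (auto simp: ignoring_def hurwitz_bij hurwitz_def fun_eq_iff)

section \<open>Injectivity\<close>

abbreviation pure_group :: "nat \<Rightarrow> (nat \<times> nat) word set monoid"
  where "pure_group n \<equiv> presented_group (pure_gens n) (pure_rels n)"

definition pure_gen :: "nat \<Rightarrow> nat \<Rightarrow> nat \<Rightarrow> (nat \<times> nat) word set"
  where "pure_gen n i j =
    (if i < j then gen (pure_gens n) (pure_rels n) (i, j) else \<one>\<^bsub>pure_group n\<^esub>)"

lemma pure_gens_iff: "(i, j) \<in> pure_gens n \<longleftrightarrow> 1 \<le> i \<and> i < j \<and> j \<le> Suc n"
  by (simp add: pure_gens_def)

lemma pure_braid_system_pure_group: "pure_braid_system (pure_group n) (pure_gen n) n"
proof -
  interpret group "pure_group n" by (rule group_presented_group)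
  let ?g = "gen (pure_gens n) (pure_rels n)"
  have cl: "?g (i, j) \<in> carrier (pure_group n)" if "1 \<le> i" "i < j" "j \<le> Suc n" for i j
    using that by (intro gen_closed) (auto simp: pure_gens_iff)
  note rel = presented_group_rel[where S = "pure_gens n" and R = "pure_rels n"]
  show ?thesis
  proof
    fix i j k l
    assume *: "1 \<le> i" "i < j" "j < k" "k < l" "l \<le> Suc n"
    then have "([pos (i, j), pos (k, l)], [pos (k, l), pos (i, j)]) \<in> pure_rels n"
      by (auto simp: pure_rels_def pure_gens_iff)
    from rel[OF this] * cl
    show "pure_gen n i j \<otimes>\<^bsub>pure_group n\<^esub> pure_gen n k l = pure_gen n k l \<otimes>\<^bsub>pure_group n\<^esub> pure_gen n i j"
      by (simp add: pure_gen_def pure_gens_iff)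
  next
    fix i j k l
    assume *: "1 \<le> i" "i \<le> k" "k < l" "l \<le> j" "j \<le> Suc n"
    then have "([pos (i, j), pos (k, l)], [pos (k, l), pos (i, j)]) \<in> pure_rels n"
      by (auto simp: pure_rels_def pure_gens_iff)
    from rel[OF this] * cl
    show "pure_gen n i j \<otimes>\<^bsub>pure_group n\<^esub> pure_gen n k l = pure_gen n k l \<otimes>\<^bsub>pure_group n\<^esub> pure_gen n i j"
      by (simp add: pure_gen_def pure_gens_iff)
  next
    fix i x j y k
    assume *: "1 \<le> i" "i < x" "x \<le> j" "j < y" "y < k" "k \<le> Suc n"
    then have "([neg (i, y), pos (i, j), pos (x, y), pos (Suc j, k), neg (x, k)],
      [neg (x, k), pos (Suc j, k), pos (x, y), pos (i, j), neg (i, y)]) \<in> pure_rels n"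
      by (auto simp: pure_rels_def)
    from rel[OF this] * cl
    show "inv\<^bsub>pure_group n\<^esub> pure_gen n i y \<otimes>\<^bsub>pure_group n\<^esub> (pure_gen n i j \<otimes>\<^bsub>pure_group n\<^esub>
        (pure_gen n x y \<otimes>\<^bsub>pure_group n\<^esub> (pure_gen n (Suc j) k \<otimes>\<^bsub>pure_group n\<^esub> inv\<^bsub>pure_group n\<^esub> pure_gen n x k))) =
      inv\<^bsub>pure_group n\<^esub> pure_gen n x k \<otimes>\<^bsub>pure_group n\<^esub> (pure_gen n (Suc j) k \<otimes>\<^bsub>pure_group n\<^esub>
        (pure_gen n x y \<otimes>\<^bsub>pure_group n\<^esub> (pure_gen n i j \<otimes>\<^bsub>pure_group n\<^esub> inv\<^bsub>pure_group n\<^esub> pure_gen n i y)))"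
      by (simp add: pure_gen_def pure_gens_iff)
  qed (use cl in \<open>auto simp: pure_gen_def\<close>)
qed


lemma (in braid_system) presented_hom_pure:
  assumes "w \<in> words_over (pure_gens n)"
  shows "presented_hom G (\<lambda>(i, j). Z i j) (pres_class (pure_gens n) (pure_rels n) w) =
    word_eval G (\<lambda>(i, j). Z i j) w"
  using assms by (intro presented_hom_class[OF Z_assignment pure_rels_hold])

lemma (in braid_system) presented_hom_pure_hom:
  "presented_hom G (\<lambda>(i, j). Z i j) \<in> hom (pure_group n) G"
  by (intro presented_hom_hom[OF Z_assignment pure_rels_hold])

lemma (in braid_system) presented_hom_pure_gen:
  assumes "1 \<le> i" "j \<le> Suc n"
  shows "presented_hom G (\<lambda>(i, j). Z i j) (pure_gen n i j) = Z i j"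
proof (cases "i < j")
  case True
  then show ?thesis using assms
    by (simp add: pure_gen_def gen_def presented_hom_pure pure_gens_iff)
next
  case False
  then show ?thesis
    using presented_hom_pure[of "[]"] by (simp add: pure_gen_def) (simp add: presented_group_def)
qed

text \<open>The relation \<open>Q\<close> is instantiated with the total relation, where only the existence of the multiplier \<open>l\<close>
  matters, and with equality, where the multiplier has to be \<open>x\<close> itself.\<close>

lemma N_marked_action:
  fixes K :: "('b, 'm) monoid_scheme"
  assumes "group K" "x \<in> pure_braid_system.N (pure_group n) (pure_gen n) n"
    and k: "\<And>i. 1 \<le> i \<Longrightarrow> i \<le> n \<Longrightarrow> k i \<in> carrier K"
      "\<And>i u. 1 \<le> i \<Longrightarrow> i \<le> n \<Longrightarrow> u \<in> carrier K \<Longrightarrow>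
        rack_pass K f i (Suc n) (u, False) = (k i \<otimes>\<^bsub>K\<^esub> u, False)"
    and Q: "Q \<one>\<^bsub>pure_group n\<^esub> \<one>\<^bsub>K\<^esub>"
      "\<And>i. 1 \<le> i \<Longrightarrow> i \<le> n \<Longrightarrow> Q (pure_braid_system.d (pure_group n) (pure_gen n) n i) (k i)"
      "\<And>i. 1 \<le> i \<Longrightarrow> i \<le> n \<Longrightarrow>
        Q (inv\<^bsub>pure_group n\<^esub> (pure_braid_system.d (pure_group n) (pure_gen n) n i)) (inv\<^bsub>K\<^esub> (k i))"
      "\<And>x y l m. Q x l \<Longrightarrow> Q y m \<Longrightarrow> Q (x \<otimes>\<^bsub>pure_group n\<^esub> y) (l \<otimes>\<^bsub>K\<^esub> m)"
  shows "\<exists>l. Q x l \<and> marked_action K f (Suc n)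
    (presented_hom Sym (\<lambda>(i, j). full_twist Sym (hurwitz K) i j) x) l"
proof -
  interpret K: group K by fact
  interpret S: braid_system Sym "hurwitz K" n by (rule K.hurwitz_braid_system)
  interpret P: pure_braid_system "pure_group n" "pure_gen n" n by (rule pure_braid_system_pure_group)
  let ?\<alpha> = "presented_hom Sym (\<lambda>(i, j). S.Z i j)"
  interpret \<alpha>: group_hom "pure_group n" Sym ?\<alpha>
    using S.presented_hom_pure_hom by unfold_locales
  have d: "marked_action K f (Suc n) (?\<alpha> (P.d i)) (k i)" if "1 \<le> i" "i \<le> n" for i
  proof -
    have "?\<alpha> (P.d i) = S.Z i (Suc n) \<otimes>\<^bsub>Sym\<^esub> inv\<^bsub>Sym\<^esub> S.Z i n"
      using that by (simp add: P.d_def S.presented_hom_pure_gen del: full_twist.simps)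
    also have "\<dots> = S.D i (Suc n)" using that by (intro S.Z_top) auto
    finally show ?thesis using that k by (simp add: K.marked_action_loop del: loop.simps)
  qed
  show ?thesis
    using assms(2) unfolding P.N_def
  proof (induction rule: generate.induct)
    case one
    then show ?case using Q(1) K.marked_action_one by (intro exI[of _ "\<one>\<^bsub>K\<^esub>"]) simp
  next
    case (incl x)
    then obtain i where "1 \<le> i" "i \<le> n" "x = P.d i" by auto
    then show ?case using Q(2) d by blast
  next
    case (inv x)
    then obtain i where i: "1 \<le> i" "i \<le> n" "x = P.d i" by auto
    then have "marked_action K f (Suc n) (?\<alpha> (inv\<^bsub>pure_group n\<^esub> x)) (inv\<^bsub>K\<^esub> (k i))"
      using K.marked_action_inv[OF d] by simp
    then show ?case using Q(3) i by blast
  next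
    case (eng x y)
    then have xy: "x \<in> carrier (pure_group n)" "y \<in> carrier (pure_group n)"
      using P.generate_in_carrier[OF P.d_subset] by auto
    obtain l m where "Q x l" "marked_action K f (Suc n) (?\<alpha> x) l" "Q y m"
      "marked_action K f (Suc n) (?\<alpha> y) m"
      using eng by blast
    then show ?case using Q(4)[of x l y m] K.marked_action_mult xy by auto
  qed
qed

text \<open>Applied with \<open>y\<close> the family \<open>d\<close> and \<open>j = n + 1\<close>,
  where \<open>d (n + 1)\<close> is one, this makes \<open>d i\<close> the product of the entries at
  \<open>i, ..., n\<close>.\<close>

lemma (in group) rack_pass_telescope:
  assumes "\<And>m. i \<le> m \<Longrightarrow> y m \<in> carrier G" "i \<le> j" "u \<in> carrier G"
  shows "rack_pass G (\<lambda>m. (y m \<otimes> inv (y (Suc m)), True)) i j (u, False) =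
    (y i \<otimes> (inv (y j) \<otimes> u), False)"
  using assms(2,3)
proof (induction j arbitrary: u rule: dec_induct)
  case base
  then show ?case using assms(1) by (cases i) auto
next
  case (step j)
  then have cl: "y i \<in> carrier G" "y j \<in> carrier G" "y (Suc j) \<in> carrier G" using assms(1) by auto
  then have "rack_op G (y j \<otimes> inv (y (Suc j)), True) (u, False) = (y j \<otimes> (inv (y (Suc j)) \<otimes> u), False)"
    using step.prems by (simp add: rack_op_def m_assoc)
  then show ?case using step cl by simp
qed

text \<open>The induction on the rank. The groups \<open>K\<close> live on the type that carries the
  presented groups of every rank, so \<open>K\<close> can be \<open>pure_group n\<close> itself and
  the hypothesis for the smaller rank quantifies over the same groups.\<close>

lemma hurwitz_faithful:
  assumes "w \<in> words_over (pure_gens n)"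
    and "\<And>K :: (nat \<times> nat) word set monoid. group K \<Longrightarrow>
      word_eval Sym (\<lambda>(i, j). full_twist Sym (hurwitz K) i j) w = id"
  shows "pres_eq (pure_gens n) (pure_rels n) w []"
  using assms
proof (induction n arbitrary: w)
  case 0
  have "pure_gens 0 = {}" by (auto simp: pure_gens_def)
  with 0 show ?case by (simp add: words_over_def pres_eq.refl)
next
  case (Suc m)
  define n where "n = Suc m"
  define \<alpha> where "\<alpha> K = presented_hom Sym (\<lambda>(i, j). full_twist Sym (hurwitz K) i j)"
    for K :: "(nat \<times> nat) word set monoid"
  interpret P: pure_braid_system "pure_group n" "pure_gen n" n by (rule pure_braid_system_pure_group)
  let ?z = "\<lambda>(p, q). pure_gen n p q"
  have eval: "word_eval (pure_group n) ?z v = pres_class (pure_gens n) (pure_rels n) v"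
    if "v \<in> words_over (pure_gens n)" for v
    using that word_eval_gen[OF that] by (subst P.word_eval_fun_cong[OF _ that, of _ "gen (pure_gens n) (pure_rels n)"])
      (auto simp: pure_gen_def pure_gens_iff)
  have w: "w \<in> words_over (pure_gens n)" using Suc.prems(1) by (simp add: n_def)
  have lower: "P.lower = pure_gens m" unfolding P.lower_def by (auto simp: pure_gens_iff n_def)
  have sub: "pure_gens m \<subseteq> pure_gens n" "pure_rels m \<subseteq> pure_rels n"
  proof -
    show "pure_gens m \<subseteq> pure_gens n" by (auto simp: pure_gens_iff n_def)
    show "pure_rels m \<subseteq> pure_rels n" unfolding pure_rels_def pure_gens_iff n_def by fastforce
  qed
  obtain x h where x: "x \<in> P.N" and h: "h \<in> generate (pure_group n) (?z ` P.lower)"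
    and wxh: "word_eval (pure_group n) ?z w = x \<otimes>\<^bsub>pure_group n\<^esub> h"
    using P.N_lower_decomp[OF P.word_eval_generate[OF w]] by blast
  obtain v where v: "v \<in> words_over (pure_gens m)" and hv: "h = word_eval (pure_group n) ?z v"
    using P.generate_word[of ?z "P.lower" h] h P.lower_closed unfolding lower by (auto simp: image_subset_iff_funcset)
  have v': "v \<in> words_over (pure_gens n)"
    using v sub(1) unfolding words_over_def by (auto dest: in_lists_conv_set[THEN iffD1])
  have xc: "x \<in> carrier (pure_group n)" using P.N_subgroup x by (rule subgroup.mem_carrier)
  have hc: "h \<in> carrier (pure_group n)" using P.generate_in_carrier[OF P.lower_closed h] .
  \<comment> \<open>As \<open>w\<close> acts trivially, \<open>x\<close> and \<open>h\<close> act as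
    mutually inverse bijections; \<open>h\<close> acts through the word \<open>v\<close> in the
    generators of smaller rank.\<close>
  have comp: "\<alpha> K x (word_eval Sym (\<lambda>(i, j). full_twist Sym (hurwitz K) i j) v f) = f"
    and trivial: "\<alpha> K (x \<otimes>\<^bsub>pure_group n\<^esub> h) = id"
    if "group K" for K f
  proof -
    interpret K: group K by fact
    interpret S: braid_system Sym "hurwitz K" n by (rule K.hurwitz_braid_system)
    interpret \<alpha>: group_hom "pure_group n" Sym "\<alpha> K"
      using S.presented_hom_pure_hom unfolding \<alpha>_def by unfold_locales
    have \<alpha>h: "\<alpha> K h = word_eval Sym (\<lambda>(i, j). full_twist Sym (hurwitz K) i j) v"
      unfolding hv eval[OF v'] \<alpha>_def by (rule S.presented_hom_pure[OF v'])
    have "\<alpha> K h \<in> carrier Sym" "\<alpha> K x \<in> carrier Sym" using xc hc by (simp_all del: Sym_carrier)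
    then have b: "bij (\<alpha> K h)" "bij (\<alpha> K x)" by simp_all
    show id: "\<alpha> K (x \<otimes>\<^bsub>pure_group n\<^esub> h) = id"
      unfolding wxh[symmetric] eval[OF w] \<alpha>_def S.presented_hom_pure[OF w]
      using Suc.prems(2)[OF that] .
    have "\<alpha> K x \<circ> \<alpha> K h = id" using id xc hc b by (simp add: Sym_mult)
    from fun_cong[OF this, of f]
    show "\<alpha> K x (word_eval Sym (\<lambda>(i, j). full_twist Sym (hurwitz K) i j) v f) = f"
      by (simp add: \<alpha>h)
  qed
  \<comment> \<open>If the entry at \<open>n + 1\<close> is marked, \<open>x\<close> changes no
    other entry, while \<open>v\<close> never touches that one. Together they act trivially, hence
    so does \<open>v\<close>.\<close>
  have "word_eval Sym (\<lambda>(i, j). full_twist Sym (hurwitz K) i j) v = id"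
    if K: "group K" for K :: "(nat \<times> nat) word set monoid"
  proof
    fix f
    interpret K: group K by fact
    interpret S: group Sym by (rule group_BijGroup)
    let ?b = "word_eval Sym (\<lambda>(i, j). full_twist Sym (hurwitz K) i j) v"
    have "?b \<in> ignoring (Suc n)"
    proof (rule S.word_eval_subgroup[OF ignoring_subgroup _ v])
      fix a assume "a \<in> pure_gens m"
      then obtain i j where a: "a = (i, j)" "1 \<le> i" "j \<le> n"
        by (cases a) (auto simp: pure_gens_iff n_def)
      have "full_twist Sym (hurwitz K) i j \<in> ignoring (Suc n)"
        using a by (intro S.full_twist_subgroup[OF ignoring_subgroup] K.hurwitz_ignoring) auto
      then show "(case a of (i, j) \<Rightarrow> full_twist Sym (hurwitz K) i j) \<in> ignoring (Suc n)"
        by (simp add: a)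
    qed
    then have loc: "?b (f(Suc n := c)) = (?b f)(Suc n := c)" for c
      unfolding ignoring_def by blast
    obtain k where k: "\<And>i. k i \<in> carrier K"
      "\<And>i u. u \<in> carrier K \<Longrightarrow> rack_pass K (?b f) i (Suc n) (u, False) = (k i \<otimes>\<^bsub>K\<^esub> u, False)"
      using K.rack_pass_marked[of "?b f" _ "Suc n"] by metis
    obtain l where "marked_action K (?b f) (Suc n) (\<alpha> K x) l"
      using N_marked_action[OF K x k, where Q = "\<lambda>_ _. True"] unfolding \<alpha>_def by auto
    then have "\<alpha> K x ((?b f)(Suc n := (\<one>\<^bsub>K\<^esub>, False))) = (?b f)(Suc n := (l \<otimes>\<^bsub>K\<^esub> \<one>\<^bsub>K\<^esub>, False))"
      by (auto simp: marked_action_def)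
    then have "f(Suc n := (\<one>\<^bsub>K\<^esub>, False)) = (?b f)(Suc n := (l \<otimes>\<^bsub>K\<^esub> \<one>\<^bsub>K\<^esub>, False))"
      unfolding loc[symmetric] comp[OF K] .
    then have "f i = ?b f i" if "i \<noteq> Suc n" for i
      using that by (metis fun_upd_other)
    \<comment> \<open>The entry at \<open>n + 1\<close> is overwritten by its own value.\<close>
    moreover have "?b f (Suc n) = f (Suc n)"
      using loc[of "f (Suc n)"] by (metis fun_upd_same fun_upd_triv)
    ultimately have "?b f i = f i" for i by (cases "i = Suc n") auto
    then show "?b f = id f" by auto
  qed
  then have "pres_eq (pure_gens m) (pure_rels m) v []" by (intro Suc.IH v)
  then have "pres_eq (pure_gens n) (pure_rels n) v []" by (rule pres_eq_mono[OF sub])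
  then have h1: "h = \<one>\<^bsub>pure_group n\<^esub>"
    unfolding hv eval[OF v'] by (simp add: pres_class_eqI presented_group_def)
  define f where "f i = (P.d i \<otimes>\<^bsub>pure_group n\<^esub> inv\<^bsub>pure_group n\<^esub> P.d (Suc i), True)" for i
  have dn: "P.d (Suc n) = \<one>\<^bsub>pure_group n\<^esub>" by (simp add: P.d_def)
  have pass: "rack_pass (pure_group n) f i (Suc n) (u, False) = (P.d i \<otimes>\<^bsub>pure_group n\<^esub> u, False)"
    if "1 \<le> i" "i \<le> n" "u \<in> carrier (pure_group n)" for i u
    using that P.rack_pass_telescope[of i P.d "Suc n" u] unfolding f_def
    by (simp add: dn del: rack_pass.simps)
  have "\<exists>l. x = l \<and> marked_action (pure_group n) f (Suc n) (\<alpha> (pure_group n) x) l"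
    unfolding \<alpha>_def
    by (rule N_marked_action[OF P.is_group x, where k = P.d])
      (use pass P.d_closed in \<open>simp_all del: rack_pass.simps\<close>)
  then have "\<alpha> (pure_group n) x (f(Suc n := (\<one>\<^bsub>pure_group n\<^esub>, False))) = f(Suc n := (x, False))"
    using xc by (auto simp: marked_action_def)
  moreover have "\<alpha> (pure_group n) x = id"
    using trivial[OF P.is_group] h1 xc by simp
  \<comment> \<open>As \<open>h\<close> is one, \<open>x\<close> acts trivially, yet it turns the
    marked \<open>\<one>\<close> at \<open>n + 1\<close> into the marked \<open>x\<close>.\<close>
  ultimately have "(f(Suc n := (\<one>\<^bsub>pure_group n\<^esub>, False))) (Suc n) = (f(Suc n := (x, False))) (Suc n)"
    by simp
  then have "x = \<one>\<^bsub>pure_group n\<^esub>" by simp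
  then have "pres_class (pure_gens n) (pure_rels n) w = \<one>\<^bsub>pure_group n\<^esub>"
    using wxh h1 unfolding eval[OF w] by simp
  then have "pres_class (pure_gens n) (pure_rels n) w = pres_class (pure_gens n) (pure_rels n) []"
    by (simp add: presented_group_def)
  then show ?case unfolding n_def[symmetric] using w by (simp add: pres_class_eq_iff)
qed

section \<open>Surjectivity\<close>

context braid_system
begin

lemma braid_conj':
  assumes "1 \<le> i" "Suc i \<le> n"
  shows "inv (s i) \<otimes> (s (Suc i) \<otimes> s i) = s (Suc i) \<otimes> (s i \<otimes> inv (s (Suc i)))"
proof -
  have cl: "s i \<in> carrier G" "s (Suc i) \<in> carrier G" using assms by (auto intro: s_closed)
  have "s (Suc i) \<otimes> s i = (s (Suc i) \<otimes> (s i \<otimes> s (Suc i))) \<otimes> inv (s (Suc i))" using cl by (simp add: m_assoc)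
  also have "\<dots> = s i \<otimes> (s (Suc i) \<otimes> (s i \<otimes> inv (s (Suc i))))"
    using cl s_braid[OF assms, symmetric] by (simp add: m_assoc)
  finally show ?thesis using cl by simp
qed

text \<open>Conjugation by \<open>s m\<close> exchanges the strands \<open>m\<close> and
  \<open>m + 1\<close>, so the pair of \<open>m + 1\<close> and \<open>j\<close> becomes that of
  \<open>m\<close> and \<open>j\<close>. The case \<open>j = m + 2\<close> is a braid relation
  applied twice; further letters commute with \<open>s m\<close>.\<close>

lemma A_shift:
  assumes "1 \<le> m" "Suc (Suc m) \<le> j" "j \<le> Suc n"
  shows "inv (s m) \<otimes> (A (Suc m) j \<otimes> s m) = A m j"
  using assms(2,3)
proof (induction j rule: dec_induct)
  case base
  let ?a = "s m" and ?b = "s (Suc m)"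
  have cl: "?a \<in> carrier G" "?b \<in> carrier G" using assms by (auto intro: s_closed)
  have "inv ?a \<otimes> (?b \<otimes> (?b \<otimes> ?a)) = inv ?a \<otimes> (?b \<otimes> ?a) \<otimes> (inv ?a \<otimes> (?b \<otimes> ?a))"
    using cl by (simp add: m_assoc)
  also have "\<dots> = ?b \<otimes> (?a \<otimes> inv ?b) \<otimes> (?b \<otimes> (?a \<otimes> inv ?b))"
    using assms by (simp only: braid_conj')
  also have "\<dots> = ?b \<otimes> (?a \<otimes> (?a \<otimes> inv ?b))" using cl by (simp add: m_assoc)
  finally show ?case using cl by (simp add: m_assoc inv_mult_group)
next
  case (step j)
  let ?A = "A (Suc m) j"
  have cl: "s m \<in> carrier G" "s j \<in> carrier G" "?A \<in> carrier G"
    using assms step by (auto intro: s_closed)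
  have c: "commuting (inv (s m)) (s j)" "commuting (inv (s j)) (s m)"
    using assms step by (auto intro!: commuting_inv s_comm)
  have "inv (s m) \<otimes> (A (Suc m) (Suc j) \<otimes> s m) = inv (s m) \<otimes> (s j \<otimes> (?A \<otimes> (inv (s j) \<otimes> s m)))"
    using assms step cl by (subst A_Suc) (auto simp: m_assoc)
  also have "\<dots> = inv (s m) \<otimes> (s j \<otimes> (?A \<otimes> (s m \<otimes> inv (s j))))"
    using commutingD(3)[OF c(2)] by simp
  also have "\<dots> = s j \<otimes> (inv (s m) \<otimes> (?A \<otimes> (s m \<otimes> inv (s j))))"
    using cl by (intro commuting_left_commute c) auto
  also have "\<dots> = s j \<otimes> ((inv (s m) \<otimes> (?A \<otimes> s m)) \<otimes> inv (s j))"
    using cl by (simp add: m_assoc)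
  also have "\<dots> = A m (Suc j)"
    using assms step by (subst A_Suc) (auto simp del: loop.simps)
  finally show ?case .
qed

section \<open>The subgroup generated by the loops and its normality\<close>

definition pure :: "'a set"
  where "pure = generate G ((\<lambda>(i, j). D i j) ` pure_gens n)"

lemma D_subset: "(\<lambda>(i, j). D i j) ` pure_gens n \<subseteq> carrier G"
  by (auto simp: pure_gens_iff)

lemma pure_subgroup: "subgroup pure G"
  unfolding pure_def by (intro generate_is_subgroup D_subset)

lemma pure_mult: "x \<in> pure \<Longrightarrow> y \<in> pure \<Longrightarrow> x \<otimes> y \<in> pure"
  using pure_subgroup by (rule subgroup.m_closed)

lemma pure_inv: "x \<in> pure \<Longrightarrow> inv x \<in> pure"
  using pure_subgroup by (rule subgroup.m_inv_closed)

lemma pure_closed: "x \<in> pure \<Longrightarrow> x \<in> carrier G"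
  using pure_subgroup by (rule subgroup.mem_carrier)

lemma D_pure: "1 \<le> i \<Longrightarrow> j \<le> Suc n \<Longrightarrow> D i j \<in> pure"
  by (cases "i < j")
    (auto simp: pure_def pure_gens_iff image_iff intro!: generate.one generate.incl bexI[of _ "(i, j)"])

lemma s_square_pure: "1 \<le> m \<Longrightarrow> m \<le> n \<Longrightarrow> s m \<otimes> s m \<in> pure"
  using D_pure[of m "Suc m"] by (simp add: s_closed)

text \<open>Since \<open>pure\<close> contains the square of \<open>s m\<close>, conjugating by
  \<open>s m\<close> and by its inverse differ by a conjugation inside \<open>pure\<close>. Either
  statement therefore implies the other, and each case proves the simpler one.\<close>

lemma conj_D_pure:
  assumes "1 \<le> m" "m \<le> n" "1 \<le> i" "i < j" "j \<le> Suc n"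
  shows "s m \<otimes> (D i j \<otimes> inv (s m)) \<in> pure" (is ?A) and "inv (s m) \<otimes> (D i j \<otimes> s m) \<in> pure" (is ?B)
proof -
  have cl: "s m \<in> carrier G" "D i j \<in> carrier G" using assms by (auto intro: s_closed)
  note sq = s_square_pure[OF assms(1,2)]
  have "?A \<or> ?B"
  proof -
    consider "m = j" | "j = Suc m" | "i \<le> m \<and> m + 2 \<le> j \<or> m + 2 \<le> i \<or> j < m" | "i = Suc m"
      using assms by linarith
    then show ?thesis
    proof cases
      case 1
      have "s m \<otimes> (D i j \<otimes> inv (s m)) = D i (Suc m) \<otimes> inv (s m \<otimes> s m)"
        using 1 cl assms by (simp add: m_assoc inv_mult_group)
      then show ?thesis using assms 1 sq by (auto intro!: pure_mult pure_inv D_pure simp del: loop.simps)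
    next
      case 2
      then have "D i m \<in> carrier G" using assms by simp
      then have "inv (s m) \<otimes> (D i j \<otimes> s m) = D i m \<otimes> (s m \<otimes> s m)"
        using 2 cl assms by (simp add: m_assoc)
      then show ?thesis using assms 2 sq by (auto intro!: pure_mult D_pure)
    next
      case 3
      then have c: "commuting (D i j) (s m)" using assms D_inner[of i m j] D_far[of i j m] by auto
      have "inv (s m) \<otimes> (D i j \<otimes> s m) = D i j" using commutingD(3)[OF c] cl by simp
      then show ?thesis using assms D_pure by simp
    next
      case 4
      let ?E = "D (Suc i) j"
      have E: "?E \<in> carrier G" using assms by simp
      have c: "commuting ?E (s m)" using 4 assms by (intro D_far) auto
      \<comment> \<open>\<open>D i j\<close> is split into \<open>A i j\<close> and
        \<open>?E\<close>: the letter \<open>s m\<close> commutes with \<open>?E\<close> and takes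
        \<open>A i j\<close> to \<open>A m j\<close>.\<close>
      have "inv (s m) \<otimes> (D i j \<otimes> s m) = inv (s m) \<otimes> (A i j \<otimes> (?E \<otimes> s m))"
        using cl E by (simp add: m_assoc)
      also have "\<dots> = inv (s m) \<otimes> (A i j \<otimes> s m) \<otimes> ?E"
        using cl E commutingD(3)[OF c] by (simp add: m_assoc)
      also have "inv (s m) \<otimes> (A i j \<otimes> s m) = A m j"
        unfolding 4 using 4 assms by (intro A_shift) auto
      also have "A m j \<otimes> ?E \<in> pure" using assms 4 by (intro pure_mult pure_inv D_pure) auto
      finally show ?thesis by simp
    qed
  qed
  moreover have "?A \<Longrightarrow> ?B"
  proof -
    assume ?A
    from pure_mult[OF pure_inv[OF sq] pure_mult[OF this sq]]
    have "inv (s m \<otimes> s m) \<otimes> (s m \<otimes> (D i j \<otimes> inv (s m)) \<otimes> (s m \<otimes> s m)) \<in> pure" .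
    then show ?B using cl by (simp add: m_assoc inv_mult_group)
  qed
  moreover have "?B \<Longrightarrow> ?A"
  proof -
    assume ?B
    from pure_mult[OF sq pure_mult[OF this pure_inv[OF sq]]]
    have "s m \<otimes> s m \<otimes> (inv (s m) \<otimes> (D i j \<otimes> s m) \<otimes> inv (s m \<otimes> s m)) \<in> pure" .
    then show ?A using cl by (simp add: m_assoc inv_mult_group)
  qed
  ultimately show ?A ?B by auto
qed

lemma s_subset: "s ` {1..n} \<subseteq> carrier G"
  by (auto intro: s_closed)

lemma pure_normalized:
  assumes "g \<in> generate G (s ` {1..n})" "x \<in> pure"
  shows "g \<otimes> (x \<otimes> inv g) \<in> pure"
  unfolding pure_def
  by (rule generate_normalize[OF D_subset s_subset _ _ _ assms(1)])
    (use assms(2) conj_D_pure in \<open>auto simp: pure_gens_iff pure_def\<close>)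

section \<open>Normal forms of permutations\<close>

lemma desc_snoc:
  assumes "1 \<le> m" "m \<le> j" "j \<le> n"
  shows "desc m (Suc j) = desc (Suc m) (Suc j) \<otimes> s m"
  using assms(2,3)
proof (induction j rule: dec_induct)
  case base
  then show ?case using assms by (simp add: s_closed)
next
  case (step j)
  then have "s m \<in> carrier G" "s (Suc j) \<in> carrier G" "desc (Suc m) (Suc j) \<in> carrier G"
    using assms by (auto intro: s_closed simp del: descend.simps)
  then have "s (Suc j) \<otimes> desc m (Suc j) = s (Suc j) \<otimes> desc (Suc m) (Suc j) \<otimes> s m"
    using step by (simp add: m_assoc del: descend.simps)
  then show ?case using step by simp
qed

text \<open>When \<open>s (p + 1)\<close> is the top letter of the run, this is one braid relation;
  higher letters commute with \<open>s p\<close>.\<close>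

lemma desc_shift:
  assumes "1 \<le> r" "r \<le> p" "Suc p \<le> j" "j \<le> n"
  shows "desc r (Suc j) \<otimes> s (Suc p) = s p \<otimes> desc r (Suc j)"
  using assms(3,4)
proof (induction j rule: dec_induct)
  case base
  let ?a = "s p" and ?b = "s (Suc p)" and ?c = "desc r p"
  have cl: "?a \<in> carrier G" "?b \<in> carrier G" "?c \<in> carrier G"
    using assms base by (auto intro: s_closed)
  have c: "commuting ?b ?c" using assms base by (intro commuting_desc s_comm s_closed) auto
  have "desc r (Suc (Suc p)) \<otimes> ?b = (?b \<otimes> (?a \<otimes> ?b)) \<otimes> ?c"
    using assms cl by (simp add: m_assoc commutingD(3)[OF c])
  also have "?b \<otimes> (?a \<otimes> ?b) = ?a \<otimes> (?b \<otimes> ?a)"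
    using assms base by (intro s_braid[symmetric]) auto
  finally show ?case using assms cl by (simp add: m_assoc)
next
  case (step j)
  have cl: "s p \<in> carrier G" "s (Suc p) \<in> carrier G" "s (Suc j) \<in> carrier G" "desc r (Suc j) \<in> carrier G"
    using assms step by (auto intro: s_closed simp del: descend.simps)
  have c: "commuting (s (Suc j)) (s p)" using assms step by (intro s_comm) auto
  have "desc r (Suc (Suc j)) \<otimes> s (Suc p) = s (Suc j) \<otimes> (desc r (Suc j) \<otimes> s (Suc p))"
    using assms step cl by (simp add: m_assoc)
  also have "\<dots> = s (Suc j) \<otimes> (s p \<otimes> desc r (Suc j))" using step by simp
  also have "\<dots> = s p \<otimes> (s (Suc j) \<otimes> desc r (Suc j))" by (intro commuting_left_commute c cl)
  finally show ?case using assms step by simp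
qed

text \<open>The union of the cosets of \<open>pure\<close> given by the normal forms of the permutations of \<open>{1..k + 1}\<close>.\<close>

primrec cosets :: "nat \<Rightarrow> 'a set"
  where
    "cosets 0 = pure"
  | "cosets (Suc k) = (\<Union>t \<in> cosets k. \<Union>r \<in> {1..Suc (Suc k)}. {t \<otimes> desc r (Suc (Suc k))})"

lemma cosets_SucI:
  "t \<in> cosets k \<Longrightarrow> 1 \<le> r \<Longrightarrow> r \<le> Suc (Suc k) \<Longrightarrow> t \<otimes> desc r (Suc (Suc k)) \<in> cosets (Suc k)"
  by (simp only: cosets.simps) (rule UN_I[of t], assumption, rule UN_I[of r], auto)

lemma cosets_SucE:
  assumes "x \<in> cosets (Suc k)"
  obtains t r where "t \<in> cosets k" "1 \<le> r" "r \<le> Suc (Suc k)" "x = t \<otimes> desc r (Suc (Suc k))"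
  using assms unfolding cosets.simps by (elim UN_E singletonE) auto

lemma cosets_closed: "k \<le> n \<Longrightarrow> x \<in> cosets k \<Longrightarrow> x \<in> carrier G"
proof (induction k arbitrary: x)
  case (Suc k)
  obtain t r where t: "t \<in> cosets k" "1 \<le> r" "r \<le> Suc (Suc k)" "x = t \<otimes> desc r (Suc (Suc k))"
    using Suc.prems(2) by (elim cosets_SucE)
  have "desc r (Suc (Suc k)) \<in> carrier G" using t Suc.prems by (intro desc_closed) auto
  with t Suc show ?case by (simp del: descend.simps)
qed (simp add: pure_closed)

lemma desc_generate:
  assumes "1 \<le> r" "j \<le> Suc n"
  shows "desc r j \<in> generate G (s ` {1..n})"
  using assms(2)
proof (induction j)
  case (Suc j)
  have "s j \<in> generate G (s ` {1..n})" if "r \<le> j"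
    using that Suc.prems assms(1) by (intro generate.incl) auto
  with Suc show ?case by (auto intro: generate.eng generate.one)
qed (simp add: generate.one)

text \<open>Normality carries \<open>p\<close> to the left across the last descending run, where the
  induction hypothesis absorbs it.\<close>

lemma cosets_pure:
  assumes "k \<le> n" "x \<in> cosets k" "p \<in> pure"
  shows "x \<otimes> p \<in> cosets k"
  using assms
proof (induction k arbitrary: x p)
  case (Suc k)
  obtain t r where t: "t \<in> cosets k" "1 \<le> r" "r \<le> Suc (Suc k)" "x = t \<otimes> desc r (Suc (Suc k))"
    using Suc.prems(2) by (elim cosets_SucE)
  let ?c = "desc r (Suc (Suc k))"
  have cl: "?c \<in> carrier G" "t \<in> carrier G" "p \<in> carrier G"
    using t Suc.prems cosets_closed[of k t] by (auto intro: pure_closed simp del: descend.simps)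
  have "?c \<otimes> (p \<otimes> inv ?c) \<in> pure"
    using t Suc.prems by (intro pure_normalized desc_generate) auto
  then have "(t \<otimes> (?c \<otimes> (p \<otimes> inv ?c))) \<otimes> ?c \<in> cosets (Suc k)"
    using t Suc by (intro cosets_SucI Suc.IH) auto
  also have "(t \<otimes> (?c \<otimes> (p \<otimes> inv ?c))) \<otimes> ?c = x \<otimes> p"
    using t cl by (simp add: m_assoc del: descend.simps)
  finally show ?case .
qed (simp add: pure_mult)

text \<open>The letter \<open>s m\<close> meets the run from \<open>s (k + 1)\<close> down to
  \<open>s r\<close>. It commutes with the run if \<open>m + 1 < r\<close>, lengthens it if
  \<open>m + 1 = r\<close>, shortens it up to the square of \<open>s m\<close> if
  \<open>m = r\<close>, and passes to the left as \<open>s (m - 1)\<close> if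
  \<open>r < m\<close>.\<close>

lemma cosets_s:
  assumes "k \<le> n" "x \<in> cosets k" "1 \<le> m" "m \<le> k"
  shows "x \<otimes> s m \<in> cosets k"
  using assms
proof (induction k arbitrary: x m)
  case (Suc k)
  obtain t r where t: "t \<in> cosets k" "1 \<le> r" "r \<le> Suc (Suc k)" "x = t \<otimes> desc r (Suc (Suc k))"
    using Suc.prems(2) by (elim cosets_SucE)
  let ?c = "\<lambda>r. desc r (Suc (Suc k))"
  have cl: "?c i \<in> carrier G" if "1 \<le> i" for i using that Suc.prems by (intro desc_closed) auto
  have tc: "t \<in> carrier G" "s m \<in> carrier G" "?c r \<in> carrier G"
    using t Suc.prems cl cosets_closed[of k t] by (auto intro: s_closed simp del: descend.simps)
  consider "Suc m < r" | "Suc m = r" | "m = r" | p where "m = Suc p" "r \<le> p"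
    using less_imp_Suc_add[of r m] by (metis add_Suc_right le_add1 less_Suc_eq linorder_neqE_nat not_less_eq)
  then show ?case
  proof cases
    case 1
    then have c: "commuting (s m) (?c r)"
      using t Suc.prems by (intro commuting_desc s_comm s_closed) auto
    have "x \<otimes> s m = (t \<otimes> s m) \<otimes> ?c r"
      using t tc by (simp add: m_assoc commutingD(3)[OF c] del: descend.simps)
    moreover have "t \<otimes> s m \<in> cosets k" using t 1 Suc by (intro Suc.IH) auto
    ultimately show ?thesis using t by (auto intro: cosets_SucI simp del: descend.simps cosets.simps)
  next
    case 2
    then have "x \<otimes> s m = t \<otimes> ?c m"
      using t Suc.prems tc desc_snoc[of m "Suc k"] by (simp add: m_assoc del: descend.simps)
    then show ?thesis using t Suc.prems by (auto intro: cosets_SucI simp del: descend.simps cosets.simps)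
  next
    case 3
    have c: "?c (Suc r) \<in> carrier G" by (rule cl) simp
    have "x \<otimes> s m = (t \<otimes> ?c (Suc r)) \<otimes> (s m \<otimes> s m)"
      using 3 t Suc.prems tc c desc_snoc[of m "Suc k"] by (simp add: m_assoc del: descend.simps)
    also have "\<dots> \<in> cosets (Suc k)"
      using 3 t Suc.prems by (intro cosets_pure s_square_pure cosets_SucI) auto
    finally show ?thesis .
  next
    case 4
    have p: "s p \<in> carrier G" "1 \<le> p" "p \<le> k" using 4 t Suc.prems by (auto intro: s_closed)
    have "x \<otimes> s m = t \<otimes> (?c r \<otimes> s (Suc p))"
      using 4 t tc by (simp add: m_assoc del: descend.simps)
    also have "\<dots> = (t \<otimes> s p) \<otimes> ?c r"
      using 4 t tc p Suc.prems by (subst desc_shift) (auto simp: m_assoc simp del: descend.simps)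
    also have "\<dots> \<in> cosets (Suc k)"
      using t p Suc by (intro cosets_SucI Suc.IH) auto
    finally show ?thesis .
  qed
qed simp

lemma cosets_total:
  assumes "g \<in> generate G (s ` {1..n})"
  shows "g \<in> cosets n"
proof -
  have gc: "g \<in> carrier G" using generate_in_carrier[OF s_subset assms] .
  have "x \<otimes> g \<in> cosets n" if "x \<in> cosets n" for x
    using assms that
  proof (induction arbitrary: x rule: generate.induct)
    case one
    then show ?case using cosets_closed[OF order_refl] by simp
  next
    case (incl h)
    then show ?case by (auto intro: cosets_s)
  next
    case (inv h)
    then obtain m where m: "1 \<le> m" "m \<le> n" "h = s m" by auto
    then have cl: "s m \<in> carrier G" "x \<in> carrier G" using inv.prems cosets_closed by (auto intro: s_closed)
    \<comment> \<open>An inverse letter is the letter times the inverse of its square, and the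
      latter lies in \<open>pure\<close>.\<close>
    have "(x \<otimes> s m) \<otimes> inv (s m \<otimes> s m) \<in> cosets n"
      using m inv by (intro cosets_pure pure_inv s_square_pure cosets_s) auto
    also have "(x \<otimes> s m) \<otimes> inv (s m \<otimes> s m) = x \<otimes> inv h"
      using cl m by (simp add: m_assoc inv_mult_group)
    finally show ?case .
  next
    case (eng h k)
    then have "h \<in> carrier G" "k \<in> carrier G" "x \<in> carrier G"
      using generate_in_carrier[OF s_subset] cosets_closed[OF order_refl] by auto
    with eng show ?case by (simp add: m_assoc[symmetric])
  qed
  moreover have "\<one> \<in> cosets k" if "k \<le> n" for k
    using that
  proof (induction k)
    case 0
    show ?case using pure_subgroup by (simp add: subgroup.one_closed)
  next
    case (Suc k)
    then have "\<one> \<otimes> desc (Suc (Suc k)) (Suc (Suc k)) \<in> cosets (Suc k)"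
      by (intro cosets_SucI) auto
    then show ?case by (simp del: descend.simps cosets.simps)
  qed
  ultimately show ?thesis using gc by (metis l_one order_refl)
qed

end

section \<open>The presentation\<close>

lemma loop_cong:
  "(\<And>m. i \<le> m \<Longrightarrow> m < j \<Longrightarrow> s m = s' m) \<Longrightarrow> loop G s i j = loop G s' i j"
  by (induction j) auto

lemma full_twist_cong:
  "(\<And>m. i \<le> m \<Longrightarrow> m < j \<Longrightarrow> s m = s' m) \<Longrightarrow> full_twist G s i j = full_twist G s' i j"
proof (induction j)
  case (Suc j)
  then show ?case using loop_cong[of i "Suc j" s s' G] by (simp del: loop.simps)
qed simp

section \<open>Telling the cosets apart by permutations\<close>

locale braid_permutation = braid_system +
  fixes \<psi> :: "'a \<Rightarrow> nat \<Rightarrow> nat"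
  assumes \<psi>_hom: "\<psi> \<in> hom G (sym_group (Suc n))"
    and \<psi>_s: "1 \<le> m \<Longrightarrow> m \<le> n \<Longrightarrow> \<psi> (s m) = transpose m (Suc m)"
begin

lemma \<psi>_mult: "x \<in> carrier G \<Longrightarrow> y \<in> carrier G \<Longrightarrow> \<psi> (x \<otimes> y) = \<psi> x \<circ> \<psi> y"
  using hom_mult[OF \<psi>_hom] by (simp add: sym_group_mult)

lemma \<psi>_one: "\<psi> \<one> = id"
  using hom_one[OF \<psi>_hom is_group sym_group_is_group] by (simp add: sym_group_one)

lemma \<psi>_D: "1 \<le> i \<Longrightarrow> j \<le> Suc n \<Longrightarrow> \<psi> (D i j) = id"
  by (induction j) (auto simp: \<psi>_one \<psi>_mult \<psi>_s s_closed)

lemma \<psi>_Z: "1 \<le> i \<Longrightarrow> j \<le> Suc n \<Longrightarrow> \<psi> (Z i j) = id"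
proof (induction j)
  case (Suc j)
  then have "\<psi> (D i (Suc j)) = id" "D i (Suc j) \<in> carrier G" by (intro \<psi>_D D_closed; simp)+
  with Suc show ?case by (simp add: \<psi>_mult del: loop.simps)
qed (simp add: \<psi>_one)

lemma \<psi>_pure:
  assumes "x \<in> pure"
  shows "\<psi> x = id"
proof -
  interpret \<psi>: group_hom G "sym_group (Suc n)" \<psi>
    using \<psi>_hom sym_group_is_group by (simp add: group_hom_def group_hom_axioms_def is_group)
  have "(\<lambda>(i, j). D i j) ` pure_gens n \<subseteq> kernel G (sym_group (Suc n)) \<psi>"
    using D_subset by (auto simp: kernel_def pure_gens_iff \<psi>_D sym_group_one)
  then have "pure \<subseteq> kernel G (sym_group (Suc n)) \<psi>"
    unfolding pure_def by (rule generate_subgroup_incl[OF _ \<psi>.subgroup_kernel])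
  with assms show ?thesis by (auto simp: kernel_def sym_group_one)
qed

lemma \<psi>_desc:
  assumes "1 \<le> r" "r \<le> j" "j \<le> Suc n"
  shows "\<psi> (desc r j) r = j \<and> (\<forall>q > j. \<psi> (desc r j) q = q)"
  using assms(2,3)
proof (induction j rule: dec_induct)
  case base
  have "desc r r = \<one>" by simp
  then show ?case by (simp add: \<psi>_one)
next
  case (step j)
  then show ?case using assms(1) by (simp add: \<psi>_mult \<psi>_s s_closed transpose_def)
qed

lemma \<psi>_cosets_above:
  assumes "k \<le> n" "t \<in> cosets k" "q > Suc k"
  shows "\<psi> t q = q"
  using assms
proof (induction k arbitrary: t)
  case 0
  then show ?case by (simp add: \<psi>_pure)
next
  case (Suc k)
  obtain t' r where t: "t' \<in> cosets k" "1 \<le> r" "r \<le> Suc (Suc k)" "t = t' \<otimes> desc r (Suc (Suc k))"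
    using Suc.prems(2) by (elim cosets_SucE)
  have "t' \<in> carrier G" using t Suc.prems cosets_closed[of k t'] by simp
  moreover have "desc r (Suc (Suc k)) \<in> carrier G" using t Suc.prems by (intro desc_closed) auto
  ultimately show ?case
    using t Suc \<psi>_desc[of r "Suc (Suc k)"] by (simp add: \<psi>_mult del: descend.simps)
qed

text \<open>The last run sends \<open>r\<close> to \<open>k + 2\<close>, which the permutation of
  the shorter normal form fixes. If the total permutation is the identity, then
  \<open>r = k + 2\<close> and the run is empty.\<close>

lemma \<psi>_cosets_kernel:
  assumes "k \<le> n" "t \<in> cosets k" "\<psi> t = id"
  shows "t \<in> pure"
  using assms
proof (induction k arbitrary: t)
  case (Suc k)
  obtain t' r where t: "t' \<in> cosets k" "1 \<le> r" "r \<le> Suc (Suc k)" "t = t' \<otimes> desc r (Suc (Suc k))"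
    using Suc.prems(2) by (elim cosets_SucE)
  let ?c = "desc r (Suc (Suc k))"
  have cl: "t' \<in> carrier G" using t Suc.prems cosets_closed[of k t'] by simp
  have "?c \<in> carrier G" using t Suc.prems by (intro desc_closed) auto
  with cl t have "\<psi> t r = \<psi> t' (\<psi> ?c r)" by (simp add: \<psi>_mult del: descend.simps)
  also have "\<dots> = Suc (Suc k)"
    using t Suc.prems \<psi>_desc[of r "Suc (Suc k)"] \<psi>_cosets_above[of k t' "Suc (Suc k)"] by simp
  finally have r: "r = Suc (Suc k)" using Suc.prems by simp
  have "?c = \<one>" unfolding r by (rule desc_triv) simp
  then have "t = t'" using t cl by simp
  then show ?case using t Suc by simp
qed simp

end

section \<open>The braid group as the universal braid system\<close>

lemma (in braid_system) braid_rels_hold: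
  assumes "(u, v) \<in> braid_rels n"
  shows "word_eval G s u = word_eval G s v"
proof -
  consider i j where "u = [pos i, pos j]" "v = [pos j, pos i]" "i \<in> {1..n}" "j \<in> {1..n}" "i + 2 \<le> j \<or> j + 2 \<le> i"
    | i where "u = [pos i, pos (i + 1), pos i]" "v = [pos (i + 1), pos i, pos (i + 1)]" "1 \<le> i" "i + 1 \<le> n"
    using assms unfolding braid_rels_def by blast
  then show ?thesis
  proof cases
    case (1 i j)
    then have "commuting (s i) (s j)" by (intro s_comm) auto
    then show ?thesis using 1 by (simp add: commuting_def)
  next
    case (2 i)
    then show ?thesis using s_braid[of i] by (simp add: s_closed)
  qed
qed

lemma (in braid_system) braid_hom:
  "presented_hom G s \<in> hom (braid_group n) G"
  unfolding braid_group_def by (rule presented_hom_hom[OF _ braid_rels_hold]) (auto intro: s_closed)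

lemma (in braid_system) braid_hom_gen:
  assumes "1 \<le> m" "m \<le> n"
  shows "presented_hom G s (gen {1..n} (braid_rels n) m) = s m"
  unfolding gen_def
  using assms s_closed[of m] by (subst presented_hom_class[OF _ braid_rels_hold]) (auto intro: s_closed)

lemma group_braid_group: "group (braid_group n)"
  unfolding braid_group_def by (rule group_presented_group)

lemma braid_permutation_braid_group:
  "braid_permutation (braid_group n) (gen {1..n} (braid_rels n)) n (braid_perm n)"
proof -
  interpret group "braid_group n" by (rule group_braid_group)
  note rel = presented_group_rel[where S = "{1..n}" and R = "braid_rels n", folded braid_group_def]
  let ?s = "gen {1..n} (braid_rels n)"
  have cl: "?s i \<in> carrier (braid_group n)" if "1 \<le> i" "i \<le> n" for i
    unfolding braid_group_def using that by (intro gen_closed) auto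
  show ?thesis
  proof
    fix i j
    assume *: "1 \<le> i" "j \<le> n" "i + 2 \<le> j"
    then have "([pos i, pos j], [pos j, pos i]) \<in> braid_rels n"
      by (auto simp: braid_rels_def)
    from rel[OF this] * cl show "?s i \<otimes>\<^bsub>braid_group n\<^esub> ?s j = ?s j \<otimes>\<^bsub>braid_group n\<^esub> ?s i"
      by simp
  next
    fix i
    assume *: "1 \<le> i" "Suc i \<le> n"
    then have "([pos i, pos (Suc i), pos i], [pos (Suc i), pos i, pos (Suc i)]) \<in> braid_rels n"
      by (auto simp: braid_rels_def)
    from rel[OF this] * cl
    show "?s i \<otimes>\<^bsub>braid_group n\<^esub> (?s (Suc i) \<otimes>\<^bsub>braid_group n\<^esub> ?s i) =
        ?s (Suc i) \<otimes>\<^bsub>braid_group n\<^esub> (?s i \<otimes>\<^bsub>braid_group n\<^esub> ?s (Suc i))"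
      by simp
  next
    show "braid_perm n \<in> hom (braid_group n) (sym_group (Suc n))"
      using braid_perm_hom[of n] by simp
  next
    fix m assume "1 \<le> m" "m \<le> n"
    then show "braid_perm n (?s m) = transpose m (Suc m)"
      using braid_perm_generator[of m n] by (simp add: gen_def)
  qed (use cl in auto)
qed

theorem corollary3p11:
  fixes n :: nat
  assumes "n \<ge> 1"
  shows "\<exists>\<phi>. \<phi> \<in> iso (presented_group (pure_gens n) (pure_rels n)) (pure_braid_group n) \<and>
    (\<forall>g \<in> pure_gens n. \<phi> (pres_class (pure_gens n) (pure_rels n) [pos g]) = zeta n g)"
proof -
  define s where "s = gen {1..n} (braid_rels n)"
  interpret B: braid_permutation "braid_group n" s n "braid_perm n"
    unfolding s_def by (rule braid_permutation_braid_group)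
  define \<phi> where "\<phi> = presented_hom (braid_group n) (\<lambda>(i, j). B.Z i j)"
  interpret P: group "pure_group n" by (rule group_presented_group)
  interpret \<phi>: group_hom "pure_group n" "braid_group n" \<phi>
    using B.presented_hom_pure_hom unfolding \<phi>_def by unfold_locales
  have \<phi>_word: "\<phi> (pres_class (pure_gens n) (pure_rels n) w) = word_eval (braid_group n) (\<lambda>(i, j). B.Z i j) w"
    if "w \<in> words_over (pure_gens n)" for w
    unfolding \<phi>_def by (rule B.presented_hom_pure[OF that])
  have \<phi>_gen: "\<phi> (pres_class (pure_gens n) (pure_rels n) [pos (i, j)]) = B.Z i j"
    if "(i, j) \<in> pure_gens n" for i j
    using that B.Z_closed[of i j] by (simp add: \<phi>_word pure_gens_iff)
  have zeta: "zeta n (i, j) = B.Z i j" if "(i, j) \<in> pure_gens n" for i j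
  proof -
    have ij: "1 \<le> i" "i < j" "j \<le> Suc n" using that by (auto simp: pure_gens_iff)
    then have "ell_word i (j - 1) \<in> words_over {1..n}"
      by (auto simp: words_over_def ell_word_def)
    then have "ell n i (j - 1) = word_eval (braid_group n) s (ell_word i (j - 1))"
      unfolding ell_def braid_group_def s_def by (rule word_eval_gen[symmetric])
    also have "\<dots> = B.H i j" using ij by (subst B.word_eval_ell_word) auto
    finally show ?thesis
      using ij B.H_square[of i j] B.H_closed[of i j] by (simp add: zeta_def numeral_2_eq_2)
  qed
  let ?K = "kernel (braid_group n) (sym_group (n + 1)) (braid_perm n)"
  have sub: "subgroup (\<phi> ` carrier (pure_group n)) (braid_group n)" by (rule \<phi>.img_is_subgroup)
  have Z_img: "B.Z i j \<in> \<phi> ` carrier (pure_group n)" if "1 \<le> i" "j \<le> Suc n" for i j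
  proof (cases "i < j")
    case True
    then have "(i, j) \<in> pure_gens n" using that by (simp add: pure_gens_iff)
    with \<phi>_gen show ?thesis
      by (intro image_eqI[of _ _ "pres_class (pure_gens n) (pure_rels n) [pos (i, j)]"])
        (auto simp: presented_group_def)
  next
    case False
    then show ?thesis using subgroup.one_closed[OF sub] B.Z_triv[of j i] by simp
  qed
  \<comment> \<open>The loops are quotients of successive full twists, so the image contains all of
    \<open>B.pure\<close>.\<close>
  have D_img: "B.D i j \<in> \<phi> ` carrier (pure_group n)" if ij: "(i, j) \<in> pure_gens n" for i j
  proof -
    obtain k where k: "j = Suc k" "1 \<le> i" "k \<le> n" using ij by (cases j) (auto simp: pure_gens_iff)
    have "B.Z i (Suc k) \<otimes>\<^bsub>braid_group n\<^esub> inv\<^bsub>braid_group n\<^esub> B.Z i k \<in> \<phi> ` carrier (pure_group n)"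
      using k by (intro subgroup.m_closed[OF sub] subgroup.m_inv_closed[OF sub] Z_img) auto
    then show ?thesis using k by (simp only: B.Z_top)
  qed
  have pure_img: "B.pure \<subseteq> \<phi> ` carrier (pure_group n)"
    unfolding B.pure_def by (rule B.generate_subgroup_incl[OF _ sub]) (use D_img in auto)
  have img: "\<phi> ` carrier (pure_group n) = ?K"
  proof
    interpret \<psi>: group_hom "braid_group n" "sym_group (n + 1)" "braid_perm n"
      using braid_perm_hom sym_group_is_group by (simp add: group_hom_def group_hom_axioms_def B.is_group)
    show "\<phi> ` carrier (pure_group n) \<subseteq> ?K"
    proof
      fix x assume "x \<in> \<phi> ` carrier (pure_group n)"
      then obtain w where w: "w \<in> words_over (pure_gens n)"
        and x: "x = word_eval (braid_group n) (\<lambda>(i, j). B.Z i j) w"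
        using \<phi>_word by (auto elim!: presented_group_carrierE)
      show "x \<in> ?K"
        unfolding x
        by (rule B.word_eval_subgroup[OF \<psi>.subgroup_kernel _ w])
          (auto simp: kernel_def pure_gens_iff B.\<psi>_Z sym_group_one)
    qed
    show "?K \<subseteq> \<phi> ` carrier (pure_group n)"
    proof
      fix x assume "x \<in> ?K"
      then have x: "x \<in> carrier (braid_group n)" "braid_perm n x = id"
        by (auto simp: kernel_def sym_group_one)
      obtain w where w: "w \<in> words_over {1..n}" "x = pres_class {1..n} (braid_rels n) w"
        using x(1) unfolding braid_group_def by (rule presented_group_carrierE)
      have "x = word_eval (braid_group n) s w"
        unfolding braid_group_def s_def w(2) by (rule word_eval_gen[OF w(1), symmetric])
      \<comment> \<open>Every braid lies in the coset of a normal form, and a trivial permutation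
        leaves only the coset \<open>B.pure\<close>.\<close>
      then have "x \<in> B.cosets n" using B.cosets_total B.word_eval_generate[OF w(1)] by blast
      then have "x \<in> B.pure" using x by (intro B.\<psi>_cosets_kernel) auto
      with pure_img show "x \<in> \<phi> ` carrier (pure_group n)" by blast
    qed
  qed
  have trivial: "X = \<one>\<^bsub>pure_group n\<^esub>" if X: "X \<in> carrier (pure_group n)" "\<phi> X = \<one>\<^bsub>braid_group n\<^esub>" for X
  proof -
    obtain w where w: "w \<in> words_over (pure_gens n)" "X = pres_class (pure_gens n) (pure_rels n) w"
      using X(1) by (rule presented_group_carrierE)
    have w1: "word_eval (braid_group n) (\<lambda>(i, j). B.Z i j) w = \<one>\<^bsub>braid_group n\<^esub>"
      using X w \<phi>_word by simp
    \<comment> \<open>The Hurwitz action factors through the braid group, so a word with trivial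
      value there acts trivially for every \<open>K\<close>.\<close>
    have "word_eval Sym (\<lambda>(i, j). full_twist Sym (hurwitz K) i j) w = id" if "group K"
      for K :: "(nat \<times> nat) word set monoid"
    proof -
      interpret K: group K by fact
      interpret S: braid_system Sym "hurwitz K" n by (rule K.hurwitz_braid_system)
      let ?\<psi> = "presented_hom Sym (hurwitz K)"
      have Z: "?\<psi> (B.Z i j) = S.Z i j" if "(i, j) \<in> pure_gens n" for i j
      proof -
        have "?\<psi> (B.Z i j) = full_twist Sym (?\<psi> \<circ> s) i j"
          using that hom_full_twist[OF B.is_group S.is_group S.braid_hom, of i j s] B.s_closed
          by (auto simp: pure_gens_iff)
        also have "\<dots> = S.Z i j"
          using that by (intro full_twist_cong) (auto simp: s_def S.braid_hom_gen[simplified] pure_gens_iff)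
        finally show ?thesis .
      qed
      have "word_eval Sym (\<lambda>(i, j). S.Z i j) w = word_eval Sym (?\<psi> \<circ> (\<lambda>(i, j). B.Z i j)) w"
        using Z by (intro S.word_eval_fun_cong[OF _ w(1)]) auto
      also have "\<dots> = ?\<psi> \<one>\<^bsub>braid_group n\<^esub>"
        unfolding w1[symmetric]
        by (rule hom_word_eval[symmetric, OF B.is_group S.is_group S.braid_hom B.Z_assignment w(1)])
      also have "\<dots> = id"
        using hom_one[OF S.braid_hom B.is_group S.is_group] by (simp add: Sym_one)
      finally show ?thesis .
    qed
    then have "pres_eq (pure_gens n) (pure_rels n) w []" by (rule hurwitz_faithful[OF w(1)])
    then show ?thesis by (simp add: w(2) pres_class_eqI presented_group_def)
  qed
  have "kernel (pure_group n) (braid_group n) \<phi> = {\<one>\<^bsub>pure_group n\<^esub>}"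
    using trivial by (auto simp: kernel_def)
  then have "inj_on \<phi> (carrier (pure_group n))" by (simp only: \<phi>.inj_iff_trivial_ker)
  with img have "bij_betw \<phi> (carrier (pure_group n)) (carrier (pure_braid_group n))"
    by (simp add: bij_betw_def pure_braid_group_def)
  moreover have "\<phi> \<in> hom (pure_group n) (pure_braid_group n)"
    using img by (intro homI) (auto simp: pure_braid_group_def)
  ultimately have "\<phi> \<in> iso (pure_group n) (pure_braid_group n)" by (simp add: iso_def)
  moreover have "\<phi> (pres_class (pure_gens n) (pure_rels n) [pos g]) = zeta n g" if "g \<in> pure_gens n" for g
    using that \<phi>_gen zeta by (cases g) simp
  ultimately show ?thesis by blast
qed

end
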